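(* Consider a PASEP model, i.e. a rate $p=1-q\in(1/2,1]$ together with a probability measure on initial configurations in $\{0,1\}^{\mathbb{Z}}$, and let $h(x,t)$ be its height function. Let $h'(x,t)$ be the height function of the PASEP with the same rate $p$ and step initial conditions. Let $v\in\mathbb{R}$ and $u\in\mathbb{R}$. Suppose there exist constants (depending on $v$, $u$ and the model) $\ell,\ell'\ge 0$; $\gamma,\gamma'\in(0,1)$; $\nu\in(0,\gamma/\gamma')$; and probability distributions $D,D'$ on $\mathbb{R}$ such that, as $t\to\infty$, $$\frac{h(vt,t)-t\ell}{t^{\gamma}}\Longrightarrow D,$$ $$\frac{h(vt+ut^{\nu},t+t^{\nu})-t\ell-t^{\nu}\ell'}{t^{\gamma}}\Longrightarrow D,$$ $$\frac{h'(ut,t)-t\ell'}{t^{\gamma'}}\Longrightarrow D',$$ where $\Longrightarrow$ denotes convergence in distribution. Then for all $M>0$, $$\lim_{t\to\infty}\mathbb{P}\bigl(|h(vt+ut^{\nu},t+t^{\nu})-h(vt,t)-t^{\nu}\ell'|\ge M t^{\gamma}\bigr)=0.$$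
   Context: The partially asymmetric simple exclusion process (PASEP) with rate $p$ is the continuous-time Markov process $(\eta_t)_{t\ge 0}$ on $\{0,1\}^{\mathbb{Z}}$ ($1$ = particle, $0$ = hole) in which each particle independently attempts to jump to its right neighboring site at rate $p$ and to its left neighboring site at rate $q=1-p$; a jump is performed only if the destination site is empty. The initial configuration is sampled from the given measure, independently of the Poisson clocks driving the dynamics. The integrated current $I(x,t)$ is the number of particles that jumped from $x$ to $x+1$ minus the number that jumped from $x+1$ to $x$ during $[0,t]$. The height function is defined for $x\in\mathbb{Z}$ by $$h(x,t)=\begin{cases}2I(0,t)+\sum_{i=1}^{x}(1-2\eta_t(i)), & x\ge 1,\\ 2I(0,t), & x=0,\\ 2I(0,t)-\sum_{i=x+1}^{0}(1-2\eta_t(i)), & x\le -1,\end{cases}$$ and by linear interpolation for non-integer $x$. Step initial conditions: at time $0$ the sites $\{\ldots,-2,-1,0\}$ are occupied and the sites $\{1,2,\ldots\}$ are empty, i.e. $h'(x,0)=|x|$. *)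

theory Defs
  imports "HOL-Probability.Probability"
begin

section \<open>Configurations and jumps\<close>

type_synonym config = "int \<Rightarrow> bool"

abbreviation config_space :: "config measure" where
  "config_space \<equiv> PiM UNIV (\<lambda>_. count_space UNIV)"

definition step_config :: config where
  "step_config = (\<lambda>x. x \<le> 0)"

text \<open>\<open>Rightward x\<close> and \<open>Leftward x\<close> are the clocks at which a particle sitting at site \<open>x\<close>
  attempts to jump to \<open>x + 1\<close> and to \<open>x - 1\<close>, respectively.\<close>

datatype clock = Rightward int | Leftward int

fun origin :: "clock \<Rightarrow> int" where
  "origin (Rightward x) = x"
| "origin (Leftward x) = x"

fun target :: "clock \<Rightarrow> int" where
  "target (Rightward x) = x + 1"
| "target (Leftward x) = x - 1"

fun rate :: "real \<Rightarrow> clock \<Rightarrow> real" where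
  "rate p (Rightward _) = p"
| "rate p (Leftward _) = 1 - p"

definition attempt :: "clock \<Rightarrow> config \<Rightarrow> config" where
  "attempt c \<zeta> = (if \<zeta> (origin c) \<and> \<not> \<zeta> (target c)
                 then \<zeta>(origin c := False, target c := True) else \<zeta>)"

section \<open>Trajectories driven by clocks\<close>

text \<open>A trajectory \<open>\<xi> :: real \<Rightarrow> config\<close> is only relevant at times \<open>t \<ge> 0\<close>.  The left limit
  \<open>before \<xi> t\<close> is taken site by site; its existence is demanded in \<open>driven\<close>.\<close>

definition before :: "(real \<Rightarrow> config) \<Rightarrow> real \<Rightarrow> config" where
  "before \<xi> t = (\<lambda>x. THE b. \<forall>\<^sub>F s in at_left t. \<xi> s x = b)"

definition driven :: "(clock \<Rightarrow> real set) \<Rightarrow> (real \<Rightarrow> config) \<Rightarrow> bool" where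
  "driven T \<xi> \<longleftrightarrow>
     (\<forall>t\<ge>0. \<forall>x. \<forall>\<^sub>F s in at_right t. \<xi> s x = \<xi> t x) \<and>
     (\<forall>t>0. \<forall>x. \<forall>\<^sub>F s in at_left t. \<xi> s x = before \<xi> t x) \<and>
     (\<forall>c. \<forall>t\<in>T c. \<xi> t = attempt c (before \<xi> t)) \<and>
     (\<forall>t>0. (\<forall>c. t \<notin> T c) \<longrightarrow> \<xi> t = before \<xi> t)"

section \<open>Current and height function\<close>

text \<open>Clocks never ring simultaneously in the process below, so at most one particle moves at a
  time, and the pair of sites \<open>(x, y)\<close> with \<open>y = x \<plusminus> 1\<close> changes from (particle, hole) to
  (hole, particle) exactly when a particle jumps from \<open>x\<close> to \<open>y\<close>.\<close>

definition jump_times :: "(real \<Rightarrow> config) \<Rightarrow> int \<Rightarrow> int \<Rightarrow> real set" where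
  "jump_times \<xi> x y = {t. 0 < t \<and> before \<xi> t x \<and> \<not> before \<xi> t y \<and> \<not> \<xi> t x \<and> \<xi> t y}"

definition current :: "(real \<Rightarrow> config) \<Rightarrow> int \<Rightarrow> real \<Rightarrow> int" where
  "current \<xi> x t = int (card (jump_times \<xi> x (x + 1) \<inter> {..t}))
                 - int (card (jump_times \<xi> (x + 1) x \<inter> {..t}))"

definition height_int :: "(real \<Rightarrow> config) \<Rightarrow> int \<Rightarrow> real \<Rightarrow> int" where
  "height_int \<xi> x t =
     (if x \<ge> 0 then 2 * current \<xi> 0 t + (\<Sum>i\<in>{1..x}. 1 - 2 * of_bool (\<xi> t i))
      else 2 * current \<xi> 0 t - (\<Sum>i\<in>{x + 1..0}. 1 - 2 * of_bool (\<xi> t i)))"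

definition height :: "(real \<Rightarrow> config) \<Rightarrow> real \<Rightarrow> real \<Rightarrow> real" where
  "height \<xi> x t = (1 - frac x) * of_int (height_int \<xi> \<lfloor>x\<rfloor> t)
                + frac x * of_int (height_int \<xi> (\<lfloor>x\<rfloor> + 1) t)"

section \<open>Poisson clocks\<close>

text \<open>A Poisson process of rate \<open>r \<ge> 0\<close>, given as a locally finite random set \<open>R\<close> of ring times.
  The Poisson weights are written out because \<open>poisson_pmf\<close> does not cover parameter \<open>0\<close>, which
  occurs for \<open>r = 0\<close> (totally asymmetric case) and for \<open>s = t\<close>.\<close>

definition rings :: "real set \<Rightarrow> real \<Rightarrow> real \<Rightarrow> nat" where
  "rings R s t = card (R \<inter> {s<..t})"

definition poisson_clock :: "'a measure \<Rightarrow> real \<Rightarrow> ('a \<Rightarrow> real set) \<Rightarrow> bool" where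
  "poisson_clock M r R \<longleftrightarrow>
     (\<forall>\<omega>\<in>space M. R \<omega> \<subseteq> {0<..} \<and> (\<forall>t. finite (R \<omega> \<inter> {..t}))) \<and>
     (\<forall>s t. 0 \<le> s \<and> s \<le> t \<longrightarrow>
        (\<lambda>\<omega>. rings (R \<omega>) s t) \<in> measurable M (count_space UNIV) \<and>
        (\<forall>k. measure M {\<omega>\<in>space M. rings (R \<omega>) s t = k} =
             (r * (t - s)) ^ k / fact k * exp (- (r * (t - s))))) \<and>
     (\<forall>\<tau> :: nat \<Rightarrow> real. 0 \<le> \<tau> 0 \<and> incseq \<tau> \<longrightarrow>
        prob_space.indep_vars M (\<lambda>_. count_space UNIV)
          (\<lambda>n \<omega>. rings (R \<omega>) (\<tau> n) (\<tau> (Suc n))) UNIV)"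

definition clock_events :: "'a measure \<Rightarrow> ('a \<Rightarrow> real set) \<Rightarrow> 'a set set" where
  "clock_events M R =
     sigma_sets (space M) {{\<omega>\<in>space M. rings (R \<omega>) 0 t = k} | t k. 0 \<le> t}"

section \<open>The PASEP\<close>

text \<open>\<open>\<mu>\<close> is the law of the initial configuration, \<open>T \<omega> c\<close> the set of ring times of clock \<open>c\<close>,
  \<open>\<eta> \<omega>\<close> the trajectory.  In the joint independence, index \<open>None\<close> stands for the initial
  configuration.  Almost sure properties of the clocks (local finiteness, no simultaneous rings)
  and of the trajectory are required at every sample point, i.e. a null set has been discarded
  from the sample space; this makes the height function a genuine random variable.\<close>

locale pasep = prob_space M
  for M :: "'a measure" and p :: real and \<mu> :: "config measure"
    and T :: "'a \<Rightarrow> clock \<Rightarrow> real set" and \<eta> :: "'a \<Rightarrow> real \<Rightarrow> config" +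
  assumes rate_bounds: "0 \<le> p" "p \<le> 1"
    and measurable_config: "0 \<le> t \<Longrightarrow> (\<lambda>\<omega>. \<eta> \<omega> t) \<in> measurable M config_space"
    and initial_law: "distr M config_space (\<lambda>\<omega>. \<eta> \<omega> 0) = \<mu>"
    and poisson: "poisson_clock M (rate p c) (\<lambda>\<omega>. T \<omega> c)"
    and independent: "indep_sets
          (\<lambda>i. case i of
                 None \<Rightarrow> {(\<lambda>\<omega>. \<eta> \<omega> 0) -` A \<inter> space M | A. A \<in> sets config_space}
               | Some c \<Rightarrow> clock_events M (\<lambda>\<omega>. T \<omega> c)) UNIV"
    and no_simultaneous_rings: "\<omega> \<in> space M \<Longrightarrow> c \<noteq> d \<Longrightarrow> T \<omega> c \<inter> T \<omega> d = {}"
    and dynamics: "\<omega> \<in> space M \<Longrightarrow> driven (T \<omega>) (\<eta> \<omega>)"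

section \<open>Convergence in distribution as time tends to infinity\<close>

definition converges_in_distr :: "'a measure \<Rightarrow> (real \<Rightarrow> 'a \<Rightarrow> real) \<Rightarrow> real measure \<Rightarrow> bool" where
  "converges_in_distr M X D \<longleftrightarrow>
     (\<forall>x. isCont (cdf D) x \<longrightarrow>
        ((\<lambda>t. cdf (distr M borel (X t)) x) \<longlongrightarrow> cdf D x) at_top)"

lemma converges_in_distr_iff_weak_conv_m:
  "converges_in_distr M X D \<longleftrightarrow>
     (\<forall>s. filterlim s at_top sequentially \<longrightarrow> weak_conv_m (\<lambda>n. distr M borel (X (s n))) D)"
proof
  assume "converges_in_distr M X D"
  then show "\<forall>s. filterlim s at_top sequentially \<longrightarrow> weak_conv_m (\<lambda>n. distr M borel (X (s n))) D"
    by (auto simp: converges_in_distr_def weak_conv_m_def weak_conv_def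
        intro: filterlim_compose)
next
  assume "\<forall>s. filterlim s at_top sequentially \<longrightarrow> weak_conv_m (\<lambda>n. distr M borel (X (s n))) D"
  then show "converges_in_distr M X D"
    unfolding converges_in_distr_def weak_conv_m_def weak_conv_def
    by (intro allI impI tendsto_at_topI_sequentially) blast
qed

section \<open>The step initial height profile\<close>

lemma height_int_step:
  fixes \<xi> :: "real \<Rightarrow> config"
  assumes "\<xi> 0 = step_config"
  shows "height_int \<xi> x 0 = \<bar>x\<bar>"
proof -
  have "current \<xi> 0 0 = 0"
  proof -
    have "jump_times \<xi> x y \<inter> {..0} = {}" for x y
      by (auto simp: jump_times_def)
    then show ?thesis
      by (simp add: current_def)
  qed
  moreover have "(\<Sum>i\<in>{1..x}. 1 - 2 * of_bool (\<xi> 0 i)) = (\<Sum>i\<in>{1..x}. 1 :: int)"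
    by (intro sum.cong) (auto simp: assms step_config_def)
  moreover have "(\<Sum>i\<in>{x + 1..0}. 1 - 2 * of_bool (\<xi> 0 i)) = (\<Sum>i\<in>{x + 1..0}. - 1 :: int)"
    by (intro sum.cong) (auto simp: assms step_config_def)
  ultimately show ?thesis
    by (simp add: height_int_def)
qed

lemma height_step:
  fixes \<xi> :: "real \<Rightarrow> config"
  assumes "\<xi> 0 = step_config"
  shows "height \<xi> x 0 = \<bar>x\<bar>"
proof (cases "0 \<le> x")
  case True
  then have "0 \<le> \<lfloor>x\<rfloor>" by simp
  then show ?thesis using True
    by (simp add: height_def height_int_step[where \<xi> = \<xi>, OF assms] frac_def algebra_simps)
next
  case False
  then have "\<lfloor>x\<rfloor> < 0" by simp
  then have "\<bar>real_of_int \<lfloor>x\<rfloor>\<bar> = - real_of_int \<lfloor>x\<rfloor>"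
    "\<bar>real_of_int (\<lfloor>x\<rfloor> + 1)\<bar> = - real_of_int \<lfloor>x\<rfloor> - 1" by linarith+
  then show ?thesis using False
    by (simp add: height_def height_int_step[where \<xi> = \<xi>, OF assms] frac_def algebra_simps)
qed

end

theory Submission
  imports Defs "HOL-Real_Asymp.Real_Asymp"
begin

text \<open>Write \<open>X\<^sub>t\<close> and \<open>Y\<^sub>t\<close> for the two rescaled heights that converge to \<open>D\<close>, taken at the point
\<open>v t\<close> at time \<open>t\<close> and at the point \<open>v t + u t\<^sup>\<nu>\<close> at time \<open>t + t\<^sup>\<nu>\<close>.  The claim is that
\<open>Y\<^sub>t - X\<^sub>t \<rightarrow> 0\<close> in probability.

The upper bound is where the dynamics enters.  A height profile is 1-Lipschitz, so at time \<open>t\<close> it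
lies below the wedge \<open>y \<mapsto> h(v t, t) + \<bar>y - v t\<bar>\<close>.  The evolution is attractive: two profiles that
are moved by the same clocks keep their order.  Hence the increment of \<open>h\<close> between the two points
is, up to a bounded rounding error, at most the height of a PASEP that starts from the wedge at time
\<open>t\<close>, and this height has the law of \<open>h'(u t\<^sup>\<nu>, t\<^sup>\<nu>)\<close> because Poisson clocks are homogeneous in space and time (lemma
\<open>step_height_dominates\<close>).  By assumption \<open>h'(u t\<^sup>\<nu>, t\<^sup>\<nu>) - t\<^sup>\<nu> l'\<close> is of order
\<open>t\<close> to the power \<open>\<nu> \<gamma>'\<close>, which is less than \<open>\<gamma>\<close>, so \<open>Y\<^sub>t - X\<^sub>t\<close> exceeds any fixed positive
number with vanishing probability.  The lower bound is soft: \<open>X\<^sub>t\<close> and \<open>Y\<^sub>t\<close> have the same limit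
law, and a family that is asymptotically dominated by another one with the same limit law cannot
stay away from it (lemma \<open>prob_gap_tendsto_0\<close>).

The domination compares laws on two different probability spaces, without any coupled process on
an infinite lattice.  During a bounded time the two clocks that move the height at a given site
stay silent with positive probability, independently over the sites.  So with probability close to
one there are such frozen sites far to the left and far to the right, and the heights between them
evolve as a finite system.  The time span is cut into short windows, so short that
with probability close to one no window sees more than one ring of the clocks in the box.
Then the order of the rings is known from the number of rings of each clock in each window, and
the heights in the box are the explicit function \<open>evolve\<close> of these numbers and of the initial
heights (lemma \<open>heights_evolve\<close>).  The numbers are independent Poisson variables, whose joint law
is the same on both spaces and after a shift of space and time, and \<open>evolve\<close> is monotone in the
initial heights.\<close>

section \<open>A monotone discrete evolution of height profiles\<close>

text \<open>A jump across the bond from \<open>x\<close> to \<open>x + 1\<close>, in either direction, changes the height at \<open>x\<close> and at no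
other site.  Clocks are therefore indexed by the height that they move.\<close>

fun height_site :: "clock \<Rightarrow> int" where
  "height_site (Rightward x) = x"
| "height_site (Leftward x) = x - 1"

definition clocks_between :: "int \<Rightarrow> int \<Rightarrow> clock set" where
  "clocks_between a b = {c. a \<le> height_site c \<and> height_site c \<le> b}"

lemma finite_clocks_between [simp]: "finite (clocks_between a b)"
proof -
  have "clocks_between a b \<subseteq> Rightward ` {a..b} \<union> Leftward ` {a+1..b+1}"
  proof
    fix c assume "c \<in> clocks_between a b"
    then show "c \<in> Rightward ` {a..b} \<union> Leftward ` {a+1..b+1}"
      by (cases c) (auto simp: clocks_between_def)
  qed
  then show ?thesis by (rule finite_subset) auto
qed

lemma attempt_away: "x \<noteq> height_site c \<Longrightarrow> x \<noteq> height_site c + 1 \<Longrightarrow> attempt c \<zeta> x = \<zeta> x"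
  by (cases c) (auto simp: attempt_def)

lemma attempt_cong:
  "\<zeta> (height_site c) = \<zeta>' (height_site c) \<Longrightarrow> \<zeta> (height_site c + 1) = \<zeta>' (height_site c + 1) \<Longrightarrow> \<zeta> x = \<zeta>' x
    \<Longrightarrow> attempt c \<zeta> x = attempt c \<zeta>' x"
  by (cases c) (auto simp: attempt_def)

text \<open>A rightward jump at \<open>x\<close> turns a local minimum of the height into a local maximum, a leftward jump
does the opposite.  For profiles with slopes \<open>\<plusminus>1\<close> both rules, including the case of a blocked jump,
are given by the minimum and the maximum over the two neighbours.  In this form they are visibly
monotone, and they make sense for every profile.\<close>

definition update :: "(clock \<Rightarrow> nat) \<Rightarrow> (int \<Rightarrow> int) \<Rightarrow> int \<Rightarrow> int" where
  "update k g x =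
     (if 0 < k (Rightward x) then min (g (x - 1)) (g (x + 1)) + 1
      else if 0 < k (Leftward (x + 1)) then max (g (x - 1)) (g (x + 1)) - 1
      else g x)"

text \<open>\<open>K i c\<close> is the number of rings of the clock \<open>c\<close> in the \<open>i\<close>-th time window.\<close>

primrec evolve :: "(nat \<Rightarrow> clock \<Rightarrow> nat) \<Rightarrow> nat \<Rightarrow> (int \<Rightarrow> int) \<Rightarrow> int \<Rightarrow> int" where
  "evolve K 0 g = g"
| "evolve K (Suc i) g = update (K i) (evolve K i g)"

definition frozen :: "(nat \<Rightarrow> clock \<Rightarrow> nat) \<Rightarrow> nat \<Rightarrow> int \<Rightarrow> bool" where
  "frozen K n a \<longleftrightarrow> (\<forall>i<n. K i (Rightward a) = 0 \<and> K i (Leftward (a + 1)) = 0)"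

text \<open>Attractiveness.  The heights at the frozen ends \<open>a\<close> and \<open>b\<close> do not change, so an order on
\<open>{a..b}\<close> persists whatever the profiles do outside.\<close>

lemma evolve_mono:
  assumes "frozen K n a" "frozen K n b" "i \<le> n"
    and "\<And>x. x \<in> {a..b} \<Longrightarrow> g x \<le> g' x" "x \<in> {a..b}"
  shows "evolve K i g x \<le> evolve K i g' x"
  using assms(3,5)
proof (induction i arbitrary: x)
  case 0
  then show ?case using assms(4) by simp
next
  case (Suc i)
  show ?case
  proof (cases "x = a \<or> x = b")
    case True
    then show ?thesis using Suc assms(1,2) by (auto simp: update_def frozen_def)
  next
    case False
    then have "evolve K i g (x - 1) \<le> evolve K i g' (x - 1)"
      "evolve K i g x \<le> evolve K i g' x"
      "evolve K i g (x + 1) \<le> evolve K i g' (x + 1)"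
      using Suc by auto
    then show ?thesis by (auto simp: update_def)
  qed
qed

lemma evolve_add: "evolve K i (\<lambda>x. g x + c) = (\<lambda>x. evolve K i g x + c)"
  by (induction i) (auto simp: update_def fun_eq_iff)

section \<open>Trajectories in windows with at most one ring\<close>

text \<open>One sample point of the PASEP: no probability is involved, and all facts below are about a
deterministic set of ring times.\<close>

locale driven_trajectory =
  fixes T :: "clock \<Rightarrow> real set" and \<xi> :: "real \<Rightarrow> config"
  assumes driven: "driven T \<xi>"
    and rings_positive: "T c \<subseteq> {0<..}"
    and rings_finite: "finite (T c \<inter> {..t})"
    and rings_disjoint: "c \<noteq> d \<Longrightarrow> T c \<inter> T d = {}"
begin

lemma ring_attempt: "r \<in> T c \<Longrightarrow> \<xi> r = attempt c (before \<xi> r)"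
  using driven by (auto simp: driven_def)

lemma site_unchanged:
  assumes "0 < r" "\<And>c. height_site c \<in> {x - 1, x} \<Longrightarrow> r \<notin> T c"
  shows "\<xi> r x = before \<xi> r x"
proof (cases "\<exists>c. r \<in> T c")
  case True
  then obtain c where c: "r \<in> T c" by blast
  then have "x \<noteq> height_site c" "x \<noteq> height_site c + 1" using assms(2)[of c] by auto
  then show ?thesis using ring_attempt[OF c] attempt_away by metis
next
  case False
  then show ?thesis using driven assms(1) by (auto simp: driven_def)
qed

text \<open>The occupation of \<open>x\<close> is right continuous with left limits, and it can jump only at rings of the
clocks of the two adjacent bonds.  Without such rings it is locally constant, hence constant on the
connected set \<open>{s..t}\<close>.\<close>

lemma site_constant:
  assumes "0 \<le> s" "s \<le> t"
    and quiet: "\<And>c r. height_site c \<in> {x - 1, x} \<Longrightarrow> s < r \<Longrightarrow> r \<le> t \<Longrightarrow> r \<notin> T c"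
  shows "\<xi> t x = \<xi> s x"
proof (rule connected_local_const[of "{s..t}"])
  show "\<forall>r\<in>{s..t}. \<forall>\<^sub>F r' in at r within {s..t}. \<xi> r x = \<xi> r' x"
  proof
    fix r assume r: "r \<in> {s..t}"
    have right: "\<forall>\<^sub>F r' in at_right r. \<xi> r' x = \<xi> r x"
      using driven r assms(1) by (auto simp: driven_def)
    then obtain b where b: "b > r" "\<And>r'. r < r' \<Longrightarrow> r' < b \<Longrightarrow> \<xi> r' x = \<xi> r x"
      unfolding eventually_at_right_field by blast
    show "\<forall>\<^sub>F r' in at r within {s..t}. \<xi> r x = \<xi> r' x"
    proof (cases "r = s")
      case True
      show ?thesis unfolding eventually_at
      proof (intro exI conjI ballI impI)
        show "0 < b - r" using b by simp
        fix r' assume "r' \<in> {s..t}" "r' \<noteq> r \<and> dist r' r < b - r"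
        then show "\<xi> r x = \<xi> r' x" using b(2)[of r'] True by (auto simp: dist_real_def)
      qed
    next
      case False
      then have "s < r" "0 < r" using r assms by auto
      then have eq: "\<xi> r x = before \<xi> r x"
        using quiet r by (intro site_unchanged) auto
      have "\<forall>\<^sub>F r' in at_left r. \<xi> r' x = before \<xi> r x"
        using driven \<open>0 < r\<close> by (auto simp: driven_def)
      then obtain a where a: "a < r" "\<And>r'. a < r' \<Longrightarrow> r' < r \<Longrightarrow> \<xi> r' x = \<xi> r x"
        unfolding eventually_at_left_field eq by blast
      show ?thesis unfolding eventually_at
      proof (intro exI conjI ballI impI)
        show "0 < min (b - r) (r - a)" using a b by simp
        fix r' assume "r' \<in> {s..t}" "r' \<noteq> r \<and> dist r' r < min (b - r) (r - a)"
        then show "\<xi> r x = \<xi> r' x" using a(2)[of r'] b(2)[of r']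
          by (cases "r' < r") (auto simp: dist_real_def)
      qed
    qed
  qed
qed (use assms in auto)

lemma site_before:
  assumes "0 \<le> s" "s < r"
    and quiet: "\<And>c r'. height_site c \<in> {x - 1, x} \<Longrightarrow> s < r' \<Longrightarrow> r' < r \<Longrightarrow> r' \<notin> T c"
  shows "before \<xi> r x = \<xi> s x"
proof -
  have "\<forall>\<^sub>F r' in at_left r. \<xi> r' x = before \<xi> r x"
    using driven assms by (auto simp: driven_def)
  moreover have "\<forall>\<^sub>F r' in at_left r. r' \<in> {s<..<r}"
    using assms(2) by (intro eventually_at_leftI[where a = s]) auto
  ultimately have "\<forall>\<^sub>F r' in at_left r. before \<xi> r x = \<xi> s x"
  proof eventually_elim
    case (elim r')
    have "\<xi> r' x = \<xi> s x"
      using elim assms by (intro site_constant) auto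
    then show ?case using elim by simp
  qed
  then show ?thesis by simp
qed

text \<open>The definition of the jump times speaks of configurations only.  A simultaneous change of
\<open>x\<close> and \<open>x + 1\<close> identifies the clock that caused it, so jump times are ring times; in particular
they are locally finite, which makes their cardinalities additive.\<close>

lemma jump_times_right:
  "jump_times \<xi> x (x + 1) = {r \<in> T (Rightward x). before \<xi> r x \<and> \<not> before \<xi> r (x + 1)}"
proof (intro set_eqI iffI)
  fix r assume r: "r \<in> jump_times \<xi> x (x + 1)"
  then have "\<xi> r \<noteq> before \<xi> r" by (auto simp: jump_times_def)
  then obtain c where c: "r \<in> T c" using driven r unfolding driven_def jump_times_def by blast
  have "c = Rightward x" using r ring_attempt[OF c]
    by (cases c) (auto simp: jump_times_def attempt_def split: if_splits)
  then show "r \<in> {r \<in> T (Rightward x). before \<xi> r x \<and> \<not> before \<xi> r (x + 1)}"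
    using r c by (auto simp: jump_times_def)
next
  fix r assume r: "r \<in> {r \<in> T (Rightward x). before \<xi> r x \<and> \<not> before \<xi> r (x + 1)}"
  then have "\<xi> r = attempt (Rightward x) (before \<xi> r)" "0 < r"
    using ring_attempt rings_positive by blast+
  then show "r \<in> jump_times \<xi> x (x + 1)" using r by (auto simp: jump_times_def attempt_def)
qed

lemma jump_times_left:
  "jump_times \<xi> (x + 1) x = {r \<in> T (Leftward (x + 1)). before \<xi> r (x + 1) \<and> \<not> before \<xi> r x}"
proof (intro set_eqI iffI)
  fix r assume r: "r \<in> jump_times \<xi> (x + 1) x"
  then have "\<xi> r \<noteq> before \<xi> r" by (auto simp: jump_times_def)
  then obtain c where c: "r \<in> T c" using driven r unfolding driven_def jump_times_def by blast
  have "c = Leftward (x + 1)" using r ring_attempt[OF c]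
    by (cases c) (auto simp: jump_times_def attempt_def split: if_splits)
  then show "r \<in> {r \<in> T (Leftward (x + 1)). before \<xi> r (x + 1) \<and> \<not> before \<xi> r x}"
    using r c by (auto simp: jump_times_def)
next
  fix r assume r: "r \<in> {r \<in> T (Leftward (x + 1)). before \<xi> r (x + 1) \<and> \<not> before \<xi> r x}"
  then have "\<xi> r = attempt (Leftward (x + 1)) (before \<xi> r)" "0 < r"
    using ring_attempt rings_positive by blast+
  then show "r \<in> jump_times \<xi> (x + 1) x" using r by (auto simp: jump_times_def attempt_def)
qed

lemma current_increment:
  assumes "s \<le> t"
  shows "current \<xi> x t - current \<xi> x s =
      int (card (jump_times \<xi> x (x + 1) \<inter> {s<..t})) - int (card (jump_times \<xi> (x + 1) x \<inter> {s<..t}))"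
proof -
  have split: "card (J \<inter> {..t}) = card (J \<inter> {..s}) + card (J \<inter> {s<..t})"
    if "finite (J \<inter> {..t})" for J :: "real set"
  proof -
    have "J \<inter> {..t} = (J \<inter> {..s}) \<union> (J \<inter> {s<..t})" using assms by auto
    then show ?thesis using that by (metis card_Un_disjoint finite_Un disjoint_iff IntE
      atMost_iff greaterThanAtMost_iff not_le)
  qed
  have "finite (jump_times \<xi> x (x + 1) \<inter> {..t})"
    unfolding jump_times_right by (rule finite_subset[OF _ rings_finite[of "Rightward x" t]]) auto
  moreover have "finite (jump_times \<xi> (x + 1) x \<inter> {..t})"
    unfolding jump_times_left by (rule finite_subset[OF _ rings_finite[of "Leftward (x + 1)" t]]) auto
  ultimately show ?thesis unfolding current_def using split by simp
qed

lemma rings_finite_window: "finite (T c \<inter> {s<..t})"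
  by (rule finite_subset[OF _ rings_finite[of c t]]) auto

lemma rings_eq_0: "rings (T c) s t = 0 \<longleftrightarrow> T c \<inter> {s<..t} = {}"
  using rings_finite_window by (simp add: rings_def)

lemma at_most_one_ring_cases:
  assumes "(\<Sum>c\<in>clocks_between a b. rings (T c) s t) \<le> 1"
  obtains (none) "\<And>c. c \<in> clocks_between a b \<Longrightarrow> T c \<inter> {s<..t} = {}"
  | (one) c r where "c \<in> clocks_between a b" "T c \<inter> {s<..t} = {r}"
      "\<And>d. d \<in> clocks_between a b \<Longrightarrow> d \<noteq> c \<Longrightarrow> T d \<inter> {s<..t} = {}"
proof (cases "\<forall>c\<in>clocks_between a b. T c \<inter> {s<..t} = {}")
  case True
  then show ?thesis using none by blast
next
  case False
  then obtain c where c: "c \<in> clocks_between a b" "T c \<inter> {s<..t} \<noteq> {}" by blast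
  then have pos: "rings (T c) s t \<noteq> 0" by (simp add: rings_eq_0)
  have "(\<Sum>c\<in>clocks_between a b. rings (T c) s t) =
      rings (T c) s t + (\<Sum>d\<in>clocks_between a b - {c}. rings (T d) s t)"
    using c(1) by (simp add: sum.remove)
  then have 1: "rings (T c) s t = 1" "(\<Sum>d\<in>clocks_between a b - {c}. rings (T d) s t) = 0"
    using pos assms by linarith+
  from 1(1) obtain r where "T c \<inter> {s<..t} = {r}" by (auto simp: rings_def card_Suc_eq)
  moreover have "T d \<inter> {s<..t} = {}" if "d \<in> clocks_between a b" "d \<noteq> c" for d
    using 1(2) that by (simp add: rings_eq_0)
  ultimately show ?thesis using one c(1) by blast
qed

lemma window_sites_none:
  assumes "0 \<le> s" "s \<le> t" "a < x" "x \<le> b"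
    and "\<And>c. c \<in> clocks_between a b \<Longrightarrow> T c \<inter> {s<..t} = {}"
  shows "\<xi> t x = \<xi> s x"
proof (rule site_constant)
  fix c r assume "height_site c \<in> {x - 1, x}" "s < r" "r \<le> t"
  then show "r \<notin> T c"
    using assms(3,4) assms(5)[of c] by (force simp: clocks_between_def disjoint_iff)
qed (use assms in auto)

lemma window_sites_one:
  assumes "0 \<le> s" "s \<le> t" "a < x" "x \<le> b"
    and c: "c \<in> clocks_between a b" "T c \<inter> {s<..t} = {r}"
      "\<And>d. d \<in> clocks_between a b \<Longrightarrow> d \<noteq> c \<Longrightarrow> T d \<inter> {s<..t} = {}"
  shows "before \<xi> r x = \<xi> s x" "\<xi> t x = attempt c (before \<xi> r) x"
proof -
  have r: "s < r" "r \<le> t" "r \<in> T c" using c(2) by auto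
  have only: "r' = r" if "height_site d \<in> {x - 1, x}" "s < r'" "r' \<le> t" "r' \<in> T d" for d r'
  proof (cases "d = c")
    case True
    then have "r' \<in> {r}" unfolding c(2)[symmetric] using that by simp
    then show ?thesis by simp
  next
    case False
    have "d \<in> clocks_between a b" using that(1) assms(3,4) by (auto simp: clocks_between_def)
    from c(3)[OF this False] that show ?thesis by (simp add: disjoint_iff)
  qed
  show "before \<xi> r x = \<xi> s x"
  proof (rule site_before)
    fix d r' assume "height_site d \<in> {x - 1, x}" "s < r'" "r' < r"
    then show "r' \<notin> T d" using only[of d r'] r by auto
  qed (use assms r in auto)
  have "\<xi> t x = \<xi> r x"
  proof (rule site_constant)
    fix d r' assume "height_site d \<in> {x - 1, x}" "r < r'" "r' \<le> t"
    then show "r' \<notin> T d" using only[of d r'] r by auto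
  qed (use assms r in auto)
  then show "\<xi> t x = attempt c (before \<xi> r) x" using ring_attempt[OF r(3)] by simp
qed

text \<open>With at most one ring in the window, a ringing clock still finds the configuration from the start
of the window.  The clocks of the neighbouring bonds must be included among the watched ones,
because they could change the sites \<open>x\<close> and \<open>x + 1\<close> first.\<close>

lemma window_current:
  assumes "0 \<le> s" "s \<le> t" "a < x" "x < b"
    and window: "(\<Sum>c\<in>clocks_between a b. rings (T c) s t) \<le> 1"
  shows "current \<xi> x t - current \<xi> x s =
      of_bool (0 < rings (T (Rightward x)) s t \<and> \<xi> s x \<and> \<not> \<xi> s (x + 1))
      - of_bool (0 < rings (T (Leftward (x + 1))) s t \<and> \<xi> s (x + 1) \<and> \<not> \<xi> s x)"
  using window
proof (cases rule: at_most_one_ring_cases)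
  case none
  have "T (Rightward x) \<inter> {s<..t} = {}" "T (Leftward (x + 1)) \<inter> {s<..t} = {}"
    using assms(3,4) by (intro none; simp add: clocks_between_def)+
  moreover from this have "jump_times \<xi> x (x + 1) \<inter> {s<..t} = {}" "jump_times \<xi> (x + 1) x \<inter> {s<..t} = {}"
    unfolding jump_times_left jump_times_right by blast+
  ultimately show ?thesis using current_increment[OF assms(2)] by (simp add: rings_def)
next
  case (one c r)
  note w = window_sites_one[OF assms(1,2) _ _ one]
  have b: "before \<xi> r x = \<xi> s x" "before \<xi> r (x + 1) = \<xi> s (x + 1)"
    using assms(3,4) by (intro w; simp)+
  have R: "T (Rightward x) \<inter> {s<..t} = (if c = Rightward x then {r} else {})"
    using assms(3,4) one by (auto simp: clocks_between_def)
  have L: "T (Leftward (x + 1)) \<inter> {s<..t} = (if c = Leftward (x + 1) then {r} else {})"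
    using assms(3,4) one by (auto simp: clocks_between_def)
  have "jump_times \<xi> x (x + 1) \<inter> {s<..t} =
      (if c = Rightward x \<and> \<xi> s x \<and> \<not> \<xi> s (x + 1) then {r} else {})"
    unfolding jump_times_right using R b by (auto split: if_splits)
  moreover have "jump_times \<xi> (x + 1) x \<inter> {s<..t} =
      (if c = Leftward (x + 1) \<and> \<xi> s (x + 1) \<and> \<not> \<xi> s x then {r} else {})"
    unfolding jump_times_left using L b by (auto split: if_splits)
  moreover have "0 < rings (T (Rightward x)) s t \<longleftrightarrow> c = Rightward x"
    "0 < rings (T (Leftward (x + 1))) s t \<longleftrightarrow> c = Leftward (x + 1)"
    using R L by (simp_all add: rings_def)
  ultimately show ?thesis using current_increment[OF assms(2)] by simp
qed

end

text \<open>Together with the value \<open>2 * current \<xi> 0 t\<close> at the origin, this determines the height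
function, without the case distinction in its definition.\<close>

lemma height_int_diff: "height_int \<xi> x t - height_int \<xi> (x - 1) t = 1 - 2 * of_bool (\<xi> t x)"
proof -
  consider "x \<ge> 1" | "x = 0" | "x < 0" by linarith
  then show ?thesis
  proof cases
    case 1
    then have "{1..x} = insert x {1..x - 1}" by auto
    then show ?thesis using 1 by (simp add: height_int_def)
  next
    case 2
    then show ?thesis by (simp add: height_int_def)
  next
    case 3
    then have "{x - 1 + 1..0} = insert x {x + 1..0}" by auto
    then have "(\<Sum>i\<in>{x - 1 + 1..0}. 1 - 2 * of_bool (\<xi> t i) :: int)
        = 1 - 2 * of_bool (\<xi> t x) + (\<Sum>i\<in>{x + 1..0}. 1 - 2 * of_bool (\<xi> t i))"
      by (simp del: diff_add_cancel)
    then show ?thesis using 3 by (simp add: height_int_def)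
  qed
qed

lemma height_int_zero: "height_int \<xi> 0 t = 2 * current \<xi> 0 t"
  by (simp add: height_int_def)

lemma height_int_lipschitz: "\<bar>height_int \<xi> x t - height_int \<xi> y t\<bar> \<le> \<bar>x - y\<bar>"
proof -
  have *: "\<bar>height_int \<xi> (y + int n) t - height_int \<xi> y t\<bar> \<le> int n" for n y
  proof (induction n)
    case (Suc n)
    have "\<bar>height_int \<xi> (y + int (Suc n)) t - height_int \<xi> (y + int n) t\<bar> \<le> 1"
      using height_int_diff[of \<xi> "y + int (Suc n)" t] by (auto simp: add.commute)
    then show ?case using Suc by linarith
  qed simp
  show ?thesis
  proof (cases "y \<le> x")
    case True
    then show ?thesis using *[of y "nat (x - y)"] by simp
  next
    case False
    then show ?thesis using *[of x "nat (y - x)"] by simp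
  qed
qed

lemma eq_on_interval_if_increments_eq:
  fixes f g :: "int \<Rightarrow> int"
  assumes "f c = g c" "a \<le> c" "c \<le> b" "\<And>x. a < x \<Longrightarrow> x \<le> b \<Longrightarrow> f x - f (x - 1) = g x - g (x - 1)"
    and "x \<in> {a..b}"
  shows "f x = g x"
proof -
  have up: "c + int n \<le> b \<Longrightarrow> f (c + int n) = g (c + int n)" for n
  proof (induction n)
    case (Suc n)
    then show ?case using assms(4)[of "c + int (Suc n)"] assms(2) by (simp add: add.commute add.left_commute)
  qed (use assms in simp)
  have down: "a \<le> c - int n \<Longrightarrow> f (c - int n) = g (c - int n)" for n
  proof (induction n)
    case (Suc n)
    then show ?case using assms(4)[of "c - int n"] assms(3) by (simp add: algebra_simps)
  qed (use assms in simp)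
  show ?thesis using up[of "nat (x - c)"] down[of "nat (c - x)"] assms(5)
    by (cases "c \<le> x") auto
qed

context driven_trajectory
begin

text \<open>Heights are pinned by the current through the bond at the origin, so the box has to contain the
origin.  The bonds at its ends must be silent: whether a jump across them succeeds depends on sites
outside the box.\<close>

lemma window_height:
  assumes "0 \<le> s" "s \<le> t" "a < 0" "0 < b"
    and window: "(\<Sum>c\<in>clocks_between a b. rings (T c) s t) \<le> 1"
    and ends: "\<And>c. height_site c \<in> {a, b} \<Longrightarrow> rings (T c) s t = 0"
    and x: "x \<in> {a..b}"
  shows "height_int \<xi> x t = update (\<lambda>c. rings (T c) s t) (\<lambda>x. height_int \<xi> x s) x"
  using window
proof (cases rule: at_most_one_ring_cases)
  case none
  have z: "rings (T c) s t = 0" if "c \<in> clocks_between a b" for c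
    using none[OF that] by (simp add: rings_def)
  have "height_int \<xi> x t = height_int \<xi> x s"
  proof (rule eq_on_interval_if_increments_eq[where c = 0 and a = a and b = b
        and f = "\<lambda>x. height_int \<xi> x t" and g = "\<lambda>x. height_int \<xi> x s"])
    show "height_int \<xi> 0 t = height_int \<xi> 0 s"
      using window_current[OF assms(1,2,3,4) window] z[of "Rightward 0"] z[of "Leftward 1"] assms(3,4)
      by (simp add: height_int_zero clocks_between_def)
    fix x assume "a < x" "x \<le> b"
    then show "height_int \<xi> x t - height_int \<xi> (x - 1) t = height_int \<xi> x s - height_int \<xi> (x - 1) s"
      using window_sites_none[OF assms(1,2) _ _ none] by (simp add: height_int_diff)
  qed (use assms in auto)
  then show ?thesis
    using x z[of "Rightward x"] z[of "Leftward (x + 1)"] by (simp add: update_def clocks_between_def)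
next
  case (one c r)
  define k where "k = height_site c"
  have "rings (T c) s t = 1" using one(2) by (simp add: rings_def)
  then have "k \<noteq> a" "k \<noteq> b" using ends[of c] by (auto simp: k_def)
  then have k: "a < k" "k < b" using one(1) by (simp_all add: clocks_between_def k_def)
  have ringing: "0 < rings (T d) s t \<longleftrightarrow> d = c" if "d \<in> clocks_between a b" for d
    using one that by (cases "d = c") (auto simp: rings_def)
  have sites: "\<xi> t y = attempt c (\<xi> s) y" if "a < y" "y \<le> b" for y
  proof -
    have "attempt c (before \<xi> r) y = attempt c (\<xi> s) y"
      using k that window_sites_one(1)[OF assms(1,2) _ _ one]
      by (intro attempt_cong) (auto simp: k_def)
    then show ?thesis using window_sites_one(2)[OF assms(1,2) that one] by simp
  qed
  \<comment> \<open>The change of the height at \<open>k\<close>, the only one in the box.\<close>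
  define d :: int where "d = (if c = Rightward k \<and> \<xi> s k \<and> \<not> \<xi> s (k + 1) then 2
    else if c = Leftward (k + 1) \<and> \<xi> s (k + 1) \<and> \<not> \<xi> s k then -2 else 0)"
  have c: "c = Rightward k \<or> c = Leftward (k + 1)" by (cases c) (auto simp: k_def)
  have "height_int \<xi> x t = height_int \<xi> x s + d * of_bool (x = k)"
  proof (rule eq_on_interval_if_increments_eq[where c = 0 and a = a and b = b
        and f = "\<lambda>x. height_int \<xi> x t" and g = "\<lambda>x. height_int \<xi> x s + d * of_bool (x = k)"])
    show "height_int \<xi> 0 t = height_int \<xi> 0 s + d * of_bool (0 = k)"
      using window_current[OF assms(1,2,3,4) window] ringing[of "Rightward 0"] ringing[of "Leftward 1"]
        assms(3,4) c
      by (auto simp: height_int_zero clocks_between_def d_def)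
    fix x assume "a < x" "x \<le> b"
    then have "\<xi> t x = attempt c (\<xi> s) x" by (rule sites)
    from c this have "of_bool (\<xi> s x) - of_bool (\<xi> t x) =
        (if x = k then d div 2 else if x = k + 1 then - (d div 2) else 0)"
      by (elim disjE) (simp_all add: attempt_def d_def)
    moreover have "d = 2 * (d div 2)" by (simp add: d_def)
    ultimately show "height_int \<xi> x t - height_int \<xi> (x - 1) t
        = height_int \<xi> x s + d * of_bool (x = k) - (height_int \<xi> (x - 1) s + d * of_bool (x - 1 = k))"
      using height_int_diff[of \<xi> x t] height_int_diff[of \<xi> x s]
      by (cases "x = k"; cases "x = k + 1") simp_all
  qed (use assms in auto)
  moreover have "update (\<lambda>c. rings (T c) s t) (\<lambda>x. height_int \<xi> x s) x = height_int \<xi> x s + d * of_bool (x = k)"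
  proof (cases "x = k")
    case True
    define h where "h y = height_int \<xi> y s" for y
    have h: "h (k - 1) = h k - (1 - 2 * of_bool (\<xi> s k))"
      "h (k + 1) = h k + (1 - 2 * of_bool (\<xi> s (k + 1)))"
      using height_int_diff[of \<xi> k s] height_int_diff[of \<xi> "k + 1" s] by (simp_all add: h_def)
    have ringing_k: "0 < rings (T (Rightward k)) s t \<longleftrightarrow> c = Rightward k"
      "0 < rings (T (Leftward (k + 1))) s t \<longleftrightarrow> c = Leftward (k + 1)"
      using k ringing[of "Rightward k"] ringing[of "Leftward (k + 1)"]
      by (auto simp: clocks_between_def)
    have "update (\<lambda>c. rings (T c) s t) h k = h k + d"
      using c
    proof
      assume "c = Rightward k"
      then show ?thesis by (simp add: update_def ringing_k h d_def)
    next
      assume "c = Leftward (k + 1)"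
      then show ?thesis by (simp add: update_def ringing_k h d_def)
    qed
    then show ?thesis using True unfolding h_def by simp
  next
    case False
    then have "\<not> 0 < rings (T (Rightward x)) s t" "\<not> 0 < rings (T (Leftward (x + 1))) s t"
      using c ringing[of "Rightward x"] ringing[of "Leftward (x + 1)"] x
      by (auto simp: clocks_between_def)
    then show ?thesis using False by (simp add: update_def)
  qed
  ultimately show ?thesis by simp
qed

end

section \<open>Heights in a box between frozen sites\<close>

fun shift_clock :: "int \<Rightarrow> clock \<Rightarrow> clock" where
  "shift_clock y (Rightward x) = Rightward (x + y)"
| "shift_clock y (Leftward x) = Leftward (x + y)"

lemma height_site_shift [simp]: "height_site (shift_clock y c) = height_site c + y"
  by (cases c) auto

lemma rate_shift [simp]: "rate p (shift_clock y c) = rate p c"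
  by (cases c) auto

lemma inj_shift_clock: "inj (shift_clock y)"
proof (rule injI)
  fix c d assume "shift_clock y c = shift_clock y d"
  then show "c = d" by (cases c; cases d) auto
qed

text \<open>The number of rings in the windows of length \<open>h\<close> after time \<open>t\<close>, seen from the site \<open>y\<close>.  The value is
\<open>0\<close> outside the box \<open>{- N..N}\<close> and after \<open>n\<close> windows, so that only finitely many
functions with values in \<open>{0, 1}\<close> occur.\<close>

definition counts ::
    "(clock \<Rightarrow> real set) \<Rightarrow> int \<Rightarrow> int \<Rightarrow> real \<Rightarrow> real \<Rightarrow> nat \<Rightarrow> nat \<Rightarrow> clock \<Rightarrow> nat" where
  "counts T y N t h n i c =
     (if i < n \<and> c \<in> clocks_between (- N) N
      then rings (T (shift_clock y c)) (t + real i * h) (t + real (Suc i) * h) else 0)"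

lemma finite_separated:
  fixes R :: "real set"
  assumes "finite R"
  shows "\<exists>d>0. \<forall>r\<in>R. \<forall>r'\<in>R. r \<noteq> r' \<longrightarrow> d \<le> \<bar>r - r'\<bar>"
  using assms
proof (induction R)
  case empty
  then show ?case by (intro exI[of _ 1]) auto
next
  case (insert x R)
  then obtain d where d: "d > 0" "\<forall>r\<in>R. \<forall>r'\<in>R. r \<noteq> r' \<longrightarrow> d \<le> \<bar>r - r'\<bar>" by blast
  obtain e where e: "e > 0" "\<forall>r\<in>R. r \<noteq> x \<longrightarrow> e \<le> dist x r"
    using finite_set_avoid[OF insert(1), of x] by blast
  have "min d e \<le> \<bar>r - r'\<bar>" if "r \<in> insert x R" "r' \<in> insert x R" "r \<noteq> r'" for r r'
    using that d(2) e(2) by (fastforce simp: dist_real_def)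
  then show ?case using d(1) e(1) by (intro exI[of _ "min d e"]) auto
qed

context driven_trajectory
begin

text \<open>Finitely many clocks ring finitely often and never simultaneously, so their rings in a
bounded time span have a positive minimal distance.\<close>

lemma eventually_at_most_one_ring:
  assumes "finite C" "0 \<le> s"
  shows "\<forall>\<^sub>F n in sequentially. \<forall>i<n.
    (\<Sum>c\<in>C. rings (T c) (t + real i * (s / n)) (t + real (Suc i) * (s / n))) \<le> 1"
proof -
  define R where "R = (\<Union>c\<in>C. T c \<inter> {t<..t + s})"
  have "finite R" unfolding R_def using assms(1) rings_finite_window by blast
  from finite_separated[OF this] obtain d
    where d: "d > 0" "\<forall>r\<in>R. \<forall>r'\<in>R. r \<noteq> r' \<longrightarrow> d \<le> \<bar>r - r'\<bar>"
    by (elim exE conjE)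
  have "\<forall>\<^sub>F n in sequentially. s / real n < d"
    using d(1) by (intro order_tendstoD[OF lim_const_over_n])
  then show ?thesis
  proof (rule eventually_mono, intro allI impI)
    fix n i assume n: "s / real n < d" and "i < (n::nat)"
    define W where "W = {t + real i * (s / n)<..t + real (Suc i) * (s / n)}"
    have h: "0 \<le> s / real n" using assms(2) by simp
    have "real (Suc i) * (s / n) \<le> real n * (s / n)"
      using h \<open>i < n\<close> by (intro mult_right_mono) auto
    then have "real (Suc i) * (s / n) \<le> s" using \<open>i < n\<close> by simp
    moreover have "0 \<le> real i * (s / n)" using assms(2) by simp
    ultimately have "W \<subseteq> {t<..t + s}" by (auto simp: W_def)
    then have WR: "(\<Union>c\<in>C. T c \<inter> W) \<subseteq> R" by (auto simp: R_def)
    have "(\<Sum>c\<in>C. rings (T c) (t + real i * (s / n)) (t + real (Suc i) * (s / n)))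
        = (\<Sum>c\<in>C. card (T c \<inter> W))" by (simp add: rings_def W_def)
    also have "\<dots> = card (\<Union>c\<in>C. T c \<inter> W)"
      using assms(1) rings_finite_window rings_disjoint unfolding W_def
      by (intro card_UN_disjoint[symmetric]) blast+
    also have "\<dots> \<le> 1"
    proof -
      have "r = r'" if "r \<in> (\<Union>c\<in>C. T c \<inter> W)" "r' \<in> (\<Union>c\<in>C. T c \<inter> W)" for r r'
      proof (rule ccontr)
        assume "r \<noteq> r'"
        moreover have "r \<in> R" "r' \<in> R" using that WR by auto
        ultimately have "d \<le> \<bar>r - r'\<bar>" using d(2) by simp
        moreover have "r \<in> W" "r' \<in> W" using that by auto
        then have "\<bar>r - r'\<bar> \<le> s / real n" by (auto simp: W_def algebra_simps add_divide_distrib)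
        ultimately show False using n by simp
      qed
      then show ?thesis using finite_subset[OF WR \<open>finite R\<close>] by (simp add: card_le_Suc0_iff_eq)
    qed
    finally show "(\<Sum>c\<in>C. rings (T c) (t + real i * (s / n)) (t + real (Suc i) * (s / n))) \<le> 1" .
  qed
qed

lemma current_zero: "current \<xi> x 0 = 0"
proof -
  have "jump_times \<xi> x y \<inter> {..0} = {}" for x y by (auto simp: jump_times_def)
  then show ?thesis by (simp add: current_def)
qed

text \<open>The right-hand side depends on the trajectory at deterministic times only, which makes it a random
variable; the current inherits measurability as a limit.\<close>

lemma current_eq_window_sum:
  assumes "0 \<le> h"
    and "\<And>i. i < n \<Longrightarrow>
      (\<Sum>c\<in>clocks_between (x - 1) (x + 1). rings (T c) (real i * h) (real (Suc i) * h)) \<le> 1"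
  shows "current \<xi> x (real n * h) = (\<Sum>i<n.
      of_bool (0 < rings (T (Rightward x)) (real i * h) (real (Suc i) * h)
        \<and> \<xi> (real i * h) x \<and> \<not> \<xi> (real i * h) (x + 1))
      - of_bool (0 < rings (T (Leftward (x + 1))) (real i * h) (real (Suc i) * h)
        \<and> \<xi> (real i * h) (x + 1) \<and> \<not> \<xi> (real i * h) x))"
  using assms(2)
proof (induction n)
  case 0
  then show ?case by (simp add: current_zero)
next
  case (Suc n)
  have "current \<xi> x (real (Suc n) * h) - current \<xi> x (real n * h) =
      of_bool (0 < rings (T (Rightward x)) (real n * h) (real (Suc n) * h)
        \<and> \<xi> (real n * h) x \<and> \<not> \<xi> (real n * h) (x + 1))
      - of_bool (0 < rings (T (Leftward (x + 1))) (real n * h) (real (Suc n) * h)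
        \<and> \<xi> (real n * h) (x + 1) \<and> \<not> \<xi> (real n * h) x)"
    using assms(1) Suc.prems[of n]
    by (intro window_current[where a = "x - 1" and b = "x + 1"]) (auto intro: mult_right_mono)
  then show ?case using Suc by simp
qed

text \<open>Between frozen sites the heights are a function of the ring numbers and of their values at time
\<open>t\<close>.  The box is centred at \<open>y\<close>, but it has to contain the origin as well, where the current is
measured.\<close>

lemma heights_evolve:
  assumes "0 \<le> t" "0 \<le> h" "- N \<le> a" "b \<le> N" "a + y < 0" "0 < b + y"
    and sparse: "\<And>i. i < n \<Longrightarrow> (\<Sum>c\<in>clocks_between (- N) N. counts T y N t h n i c) \<le> 1"
    and frozen: "frozen (counts T y N t h n) n a" "frozen (counts T y N t h n) n b"
    and "i \<le> n" "x \<in> {a..b}"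
  shows "height_int \<xi> (x + y) (t + real i * h)
    = evolve (counts T y N t h n) i (\<lambda>x. height_int \<xi> (x + y) t) x"
  using assms(10,11)
proof (induction i arbitrary: x)
  case 0
  then show ?case by simp
next
  case (Suc i)
  define s s' where "s = t + real i * h" and "s' = t + real (Suc i) * h"
  have times: "0 \<le> s" "s \<le> s'" using assms(1,2) by (simp_all add: s_def s'_def algebra_simps)
  have box: "clocks_between (a + y) (b + y) \<subseteq> shift_clock y ` clocks_between (- N) N"
  proof
    fix c assume "c \<in> clocks_between (a + y) (b + y)"
    then have "c = shift_clock y (shift_clock (- y) c)"
      "shift_clock (- y) c \<in> clocks_between (- N) N"
      using assms(3,4) by (cases c; auto simp: clocks_between_def)+
    then show "c \<in> shift_clock y ` clocks_between (- N) N" by blast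
  qed
  have count: "counts T y N t h n i c = rings (T (shift_clock y c)) s s'" if "c \<in> clocks_between (- N) N" for c
    using that Suc.prems by (simp add: counts_def s_def s'_def)
  have "(\<Sum>c\<in>clocks_between (a + y) (b + y). rings (T c) s s')
      \<le> (\<Sum>c\<in>shift_clock y ` clocks_between (- N) N. rings (T c) s s')"
    using box by (intro sum_mono2) auto
  also have "\<dots> = (\<Sum>c\<in>clocks_between (- N) N. counts T y N t h n i c)"
    using inj_on_subset[OF inj_shift_clock]
    by (subst sum.reindex) (auto simp: count intro!: sum.cong)
  also have "\<dots> \<le> 1" using sparse Suc.prems by simp
  finally have window: "(\<Sum>c\<in>clocks_between (a + y) (b + y). rings (T c) s s') \<le> 1" .
  have ends: "rings (T c) s s' = 0" if "height_site c \<in> {a + y, b + y}" for c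
  proof -
    define d where "d = shift_clock (- y) c"
    have d: "c = shift_clock y d" "height_site d \<in> {a, b}" using that by (cases c; auto simp: d_def)+
    then have "counts T y N t h n i d = 0"
      using frozen Suc.prems by (cases d) (auto simp: frozen_def)
    moreover have "d \<in> clocks_between (- N) N"
      using d(2) assms(3-6) by (auto simp: clocks_between_def)
    ultimately show ?thesis using count d(1) by simp
  qed
  have "height_int \<xi> (x + y) s' = update (\<lambda>c. rings (T c) s s') (\<lambda>x. height_int \<xi> x s) (x + y)"
    using Suc.prems by (intro window_height[OF times assms(5,6) window ends]) auto
  also have "\<dots> = update (counts T y N t h n i) (\<lambda>x. height_int \<xi> (x + y) s) x"
    using Suc.prems assms(3,4) count[of "Rightward x"] count[of "Leftward (x + 1)"]
    by (simp add: update_def clocks_between_def algebra_simps)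
  also have "\<dots> = update (counts T y N t h n i) (evolve (counts T y N t h n) i (\<lambda>x. height_int \<xi> (x + y) t)) x"
  proof (cases "x = a \<or> x = b")
    case True
    then have "counts T y N t h n i (Rightward x) = 0" "counts T y N t h n i (Leftward (x + 1)) = 0"
      using frozen Suc.prems by (auto simp: frozen_def)
    then show ?thesis using Suc by (simp add: update_def s_def)
  next
    case False
    then have "x - 1 \<in> {a..b}" "x + 1 \<in> {a..b}" using Suc.prems by auto
    then show ?thesis using Suc by (simp add: update_def s_def)
  qed
  finally show ?case by (simp add: s'_def)
qed

end

section \<open>Measurability and the law of the ring numbers\<close>

lemma (in prob_space) prob_tendsto_0_if_eventually_outside:
  assumes "\<And>n. A n \<in> events" "\<And>\<omega>. \<omega> \<in> space M \<Longrightarrow> \<forall>\<^sub>F n in sequentially. \<omega> \<notin> A n"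
  shows "(\<lambda>n. prob (A n)) \<longlonglongrightarrow> 0"
proof -
  have "(\<lambda>n. \<integral>\<omega>. indicat_real (A n) \<omega> \<partial>M) \<longlonglongrightarrow> (\<integral>\<omega>. 0 \<partial>M)"
  proof (rule integral_dominated_convergence[where w = "\<lambda>_. 1"])
    show "AE \<omega> in M. (\<lambda>n. indicat_real (A n) \<omega>) \<longlonglongrightarrow> 0"
    proof (rule AE_I2)
      fix \<omega> assume "\<omega> \<in> space M"
      then show "(\<lambda>n. indicat_real (A n) \<omega>) \<longlonglongrightarrow> 0"
        using assms(2)[of \<omega>] by (intro tendsto_eventually) (auto elim: eventually_mono)
    qed
  qed (use assms(1) in \<open>auto simp: indicator_def\<close>)
  then show ?thesis using assms(1) by simp
qed

definition poisson_weight :: "real \<Rightarrow> nat \<Rightarrow> real" where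
  "poisson_weight r k = r ^ k / fact k * exp (- r)"

context pasep
begin

lemma driven_trajectory: "\<omega> \<in> space M \<Longrightarrow> driven_trajectory (T \<omega>) (\<eta> \<omega>)"
  using poisson dynamics no_simultaneous_rings
  by (unfold_locales) (auto simp: poisson_clock_def)

lemma measurable_rings [measurable]:
  "0 \<le> s \<Longrightarrow> s \<le> t \<Longrightarrow> (\<lambda>\<omega>. rings (T \<omega> c) s t) \<in> measurable M (count_space UNIV)"
  using poisson by (simp add: poisson_clock_def)

lemma measurable_site: "0 \<le> t \<Longrightarrow> (\<lambda>\<omega>. \<eta> \<omega> t x) \<in> measurable M (count_space UNIV)"
  using measurable_compose[OF measurable_config measurable_component_singleton] by simp

lemma prob_rings:
  assumes "0 \<le> s" "s \<le> t"
  shows "prob {\<omega>\<in>space M. rings (T \<omega> c) s t = k} = poisson_weight (rate p c * (t - s)) k"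
  using poisson assms by (simp add: poisson_clock_def poisson_weight_def)

text \<open>\<open>clock_events\<close> is generated by the ring numbers since time \<open>0\<close>; those of later windows
are differences of them.\<close>

lemma rings_clock_event:
  assumes "0 \<le> s" "s \<le> t"
  shows "{\<omega>\<in>space M. rings (T \<omega> c) s t = k} \<in> clock_events M (\<lambda>\<omega>. T \<omega> c)"
proof -
  let ?G = "{{\<omega>\<in>space M. rings (T \<omega> c) 0 t = k} | t k. 0 \<le> t}"
  interpret S: sigma_algebra "space M" "clock_events M (\<lambda>\<omega>. T \<omega> c)"
    unfolding clock_events_def by (rule sigma_algebra_sigma_sets) auto
  have basic: "{\<omega>\<in>space M. rings (T \<omega> c) 0 u = j} \<in> clock_events M (\<lambda>\<omega>. T \<omega> c)" if "0 \<le> u" for u j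
    unfolding clock_events_def using that by (intro sigma_sets.Basic) blast
  have add: "rings (T \<omega> c) 0 t = rings (T \<omega> c) 0 s + rings (T \<omega> c) s t" if "\<omega> \<in> space M" for \<omega>
  proof -
    interpret driven_trajectory "T \<omega>" "\<eta> \<omega>" using driven_trajectory[OF that] .
    have "T \<omega> c \<inter> {0<..t} = (T \<omega> c \<inter> {0<..s}) \<union> (T \<omega> c \<inter> {s<..t})" using assms by auto
    then show ?thesis unfolding rings_def
      using rings_finite_window by (simp add: card_Un_disjoint disjoint_iff)
  qed
  have "{\<omega>\<in>space M. rings (T \<omega> c) s t = k} =
      (\<Union>j. {\<omega>\<in>space M. rings (T \<omega> c) 0 s = j} \<inter> {\<omega>\<in>space M. rings (T \<omega> c) 0 t = j + k})"
    using add by auto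
  also have "\<dots> \<in> clock_events M (\<lambda>\<omega>. T \<omega> c)"
    using assms by (intro S.countable_nat_UN) (auto intro!: basic S.Int)
  finally show ?thesis .
qed

lemma clock_events_sets: "clock_events M (\<lambda>\<omega>. T \<omega> c) \<subseteq> events"
  unfolding clock_events_def by (intro sets.sigma_sets_subset) (auto intro: measurable_sets_Collect)

text \<open>Independence of the clocks.  The set comprehension covers an empty \<open>C\<close>, for which an
intersection would not stay inside the sample space.\<close>

lemma prob_clock_events:
  assumes "finite C" "\<And>c. c \<in> C \<Longrightarrow> E c \<in> clock_events M (\<lambda>\<omega>. T \<omega> c)"
  shows "prob {\<omega>\<in>space M. \<forall>c\<in>C. \<omega> \<in> E c} = (\<Prod>c\<in>C. prob (E c))"
proof (cases "C = {}")
  case True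
  then show ?thesis by (simp add: prob_space)
next
  case False
  have sub: "E c \<subseteq> space M" if "c \<in> C" for c
    using assms(2)[OF that] clock_events_sets sets.sets_into_space by blast
  have "prob (\<Inter>i\<in>Some ` C. E (the i)) = (\<Prod>i\<in>Some ` C. prob (E (the i)))"
    using assms False by (intro indep_setsD[OF independent]) auto
  moreover have "(\<Inter>i\<in>Some ` C. E (the i)) = {\<omega>\<in>space M. \<forall>c\<in>C. \<omega> \<in> E c}"
    using sub False by auto
  ultimately show ?thesis by (simp add: prod.reindex)
qed

lemma real_current_measurable:
  assumes "0 \<le> t"
  shows "(\<lambda>\<omega>. real_of_int (current (\<eta> \<omega>) x t)) \<in> borel_measurable M"
proof (rule borel_measurable_LIMSEQ_real)
  let ?s = "\<lambda>n i. real i * (t / real n)"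
  let ?f = "\<lambda>n \<omega>. real_of_int (\<Sum>i<n.
      of_bool (0 < rings (T \<omega> (Rightward x)) (?s n i) (?s n (Suc i))
        \<and> \<eta> \<omega> (?s n i) x \<and> \<not> \<eta> \<omega> (?s n i) (x + 1))
      - of_bool (0 < rings (T \<omega> (Leftward (x + 1))) (?s n i) (?s n (Suc i))
        \<and> \<eta> \<omega> (?s n i) (x + 1) \<and> \<not> \<eta> \<omega> (?s n i) x))"
  show "(\<lambda>\<omega>. ?f n \<omega>) \<in> borel_measurable M" for n
  proof -
    have "0 \<le> t / real n" using assms by simp
    then have times: "0 \<le> ?s n i" "?s n i \<le> ?s n (Suc i)" for i
      by (auto intro!: mult_right_mono mult_nonneg_nonneg simp del: times_divide_eq_right)
    have m: "(\<lambda>\<omega>. rings (T \<omega> c) (?s n i) (?s n (Suc i))) \<in> measurable M (count_space UNIV)" for c i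
      using times by (rule measurable_rings)
    have m': "(\<lambda>\<omega>. \<eta> \<omega> (?s n i) x) \<in> measurable M (count_space UNIV)" for x i
      using times(1) by (rule measurable_site)
    show ?thesis
      unfolding of_int_sum of_int_diff of_int_of_bool
      using m m' by (intro borel_measurable_sum borel_measurable_diff; measurable)
  qed
  fix \<omega> assume "\<omega> \<in> space M"
  then interpret driven_trajectory "T \<omega>" "\<eta> \<omega>" by (rule driven_trajectory)
  have "\<forall>\<^sub>F n in sequentially. real_of_int (current (\<eta> \<omega>) x t) = ?f n \<omega>"
    using eventually_at_most_one_ring[OF finite_clocks_between[of "x - 1" "x + 1"] assms, of 0]
      eventually_gt_at_top[of 0]
  proof eventually_elim
    case (elim n)
    then have "current (\<eta> \<omega>) x (real n * (t / real n)) = (\<Sum>i<n.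
      of_bool (0 < rings (T \<omega> (Rightward x)) (?s n i) (?s n (Suc i))
        \<and> \<eta> \<omega> (?s n i) x \<and> \<not> \<eta> \<omega> (?s n i) (x + 1))
      - of_bool (0 < rings (T \<omega> (Leftward (x + 1))) (?s n i) (?s n (Suc i))
        \<and> \<eta> \<omega> (?s n i) (x + 1) \<and> \<not> \<eta> \<omega> (?s n i) x))"
      using assms by (intro current_eq_window_sum) auto
    then show ?case using elim by simp
  qed
  then show "(\<lambda>n. ?f n \<omega>) \<longlonglongrightarrow> real_of_int (current (\<eta> \<omega>) x t)"
    by (rule tendsto_eventually[OF eventually_mono]) simp
qed

lemma real_height_int_measurable:
  assumes "0 \<le> t"
  shows "(\<lambda>\<omega>. real_of_int (height_int (\<eta> \<omega>) x t)) \<in> borel_measurable M"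
proof -
  note m = measurable_site[OF assms] real_current_measurable[OF assms, of 0]
  have [measurable]: "(\<lambda>\<omega>. of_bool (\<eta> \<omega> t i) :: real) \<in> borel_measurable M" for i
    using measurable_compose[OF m(1), of "\<lambda>b. of_bool b :: real"] by simp
  show ?thesis
    using m(2) by (cases "0 \<le> x") (simp_all add: height_int_def)
qed

lemma height_measurable:
  assumes "0 \<le> t"
  shows "(\<lambda>\<omega>. height (\<eta> \<omega>) x t) \<in> borel_measurable M"
  unfolding height_def using real_height_int_measurable[OF assms] by measurable

lemma prob_window_counts:
  assumes "0 \<le> t" "0 \<le> h" "0 < n"
  shows "prob {\<omega>\<in>space M. \<forall>i<n. rings (T \<omega> c) (t + real i * h) (t + real (Suc i) * h) = k i}
    = (\<Prod>i<n. poisson_weight (rate p c * h) (k i))"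
proof -
  define \<tau> where "\<tau> i = t + real i * h" for i
  have \<tau>: "0 \<le> \<tau> i" "\<tau> i \<le> \<tau> (Suc i)" "\<tau> (Suc i) - \<tau> i = h" for i
    using assms by (simp_all add: \<tau>_def algebra_simps)
  have "indep_vars (\<lambda>_. count_space UNIV) (\<lambda>i \<omega>. rings (T \<omega> c) (\<tau> i) (\<tau> (Suc i))) UNIV"
    using poisson[of c] \<tau> incseq_SucI[of \<tau>] by (simp add: poisson_clock_def)
  then have "prob (\<Inter>i\<in>{..<n}. (\<lambda>\<omega>. rings (T \<omega> c) (\<tau> i) (\<tau> (Suc i))) -` {k i} \<inter> space M)
      = (\<Prod>i<n. prob ((\<lambda>\<omega>. rings (T \<omega> c) (\<tau> i) (\<tau> (Suc i))) -` {k i} \<inter> space M))"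
    using assms(3) by (intro indep_varsD) auto
  moreover have "(\<lambda>\<omega>. rings (T \<omega> c) (\<tau> i) (\<tau> (Suc i))) -` {k i} \<inter> space M
      = {\<omega>\<in>space M. rings (T \<omega> c) (\<tau> i) (\<tau> (Suc i)) = k i}" for i by auto
  ultimately have "prob (\<Inter>i<n. {\<omega>\<in>space M. rings (T \<omega> c) (\<tau> i) (\<tau> (Suc i)) = k i})
      = (\<Prod>i<n. prob {\<omega>\<in>space M. rings (T \<omega> c) (\<tau> i) (\<tau> (Suc i)) = k i})"
    by (simp only:)
  also have "\<dots> = (\<Prod>i<n. poisson_weight (rate p c * h) (k i))"
    using prob_rings[OF \<tau>(1,2)] \<tau>(3) by simp
  also have "(\<Inter>i<n. {\<omega>\<in>space M. rings (T \<omega> c) (\<tau> i) (\<tau> (Suc i)) = k i})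
      = {\<omega>\<in>space M. \<forall>i<n. rings (T \<omega> c) (\<tau> i) (\<tau> (Suc i)) = k i}" using assms(3) by auto
  finally show ?thesis by (simp only: \<tau>_def)
qed

lemma window_counts_clock_event:
  assumes "0 \<le> t" "0 \<le> h"
  shows "{\<omega>\<in>space M. \<forall>i<n. rings (T \<omega> c) (t + real i * h) (t + real (Suc i) * h) = k i}
    \<in> clock_events M (\<lambda>\<omega>. T \<omega> c)"
proof -
  interpret S: sigma_algebra "space M" "clock_events M (\<lambda>\<omega>. T \<omega> c)"
    unfolding clock_events_def by (rule sigma_algebra_sigma_sets) auto
  show ?thesis
  proof (induction n)
    case 0
    then show ?case using S.top by simp
  next
    case (Suc n)
    have "{\<omega>\<in>space M. \<forall>i<Suc n. rings (T \<omega> c) (t + real i * h) (t + real (Suc i) * h) = k i}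
      = {\<omega>\<in>space M. \<forall>i<n. rings (T \<omega> c) (t + real i * h) (t + real (Suc i) * h) = k i}
        \<inter> {\<omega>\<in>space M. rings (T \<omega> c) (t + real n * h) (t + real (Suc n) * h) = k n}"
      by (auto simp: less_Suc_eq)
    also have "\<dots> \<in> clock_events M (\<lambda>\<omega>. T \<omega> c)"
      using assms Suc by (intro S.Int rings_clock_event) (auto intro: mult_right_mono)
    finally show ?case .
  qed
qed

text \<open>Neither \<open>t\<close> nor \<open>y\<close> occurs in the probability: this is the homogeneity of the clocks in time and
space.\<close>

lemma counts_law:
  assumes "0 \<le> t" "0 \<le> h" "0 < n"
    and support: "\<And>i c. \<not> (i < n \<and> c \<in> clocks_between (- N) N) \<Longrightarrow> K i c = 0"
  shows "{\<omega>\<in>space M. counts (T \<omega>) y N t h n = K} \<in> events"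
    and "prob {\<omega>\<in>space M. counts (T \<omega>) y N t h n = K}
      = (\<Prod>c\<in>clocks_between (- N) N. \<Prod>i<n. poisson_weight (rate p c * h) (K i c))"
proof -
  let ?C = "shift_clock y ` clocks_between (- N) N"
  have [simp]: "inv (shift_clock y) (shift_clock y c) = c" for c
    using inj_shift_clock by (rule inv_f_f)
  define E where "E c = {\<omega>\<in>space M. \<forall>i<n. rings (T \<omega> c) (t + real i * h) (t + real (Suc i) * h)
    = K i (inv (shift_clock y) c)}" for c
  have eq: "{\<omega>\<in>space M. counts (T \<omega>) y N t h n = K} = {\<omega>\<in>space M. \<forall>c\<in>?C. \<omega> \<in> E c}"
    using support by (auto simp: fun_eq_iff counts_def E_def)
  have E: "E c \<in> clock_events M (\<lambda>\<omega>. T \<omega> c)" for c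
    unfolding E_def using assms by (intro window_counts_clock_event)
  show "{\<omega>\<in>space M. counts (T \<omega>) y N t h n = K} \<in> events"
  proof -
    have "{\<omega>\<in>space M. \<omega> \<in> E c} = E c" for c by (auto simp: E_def)
    then have "{\<omega>\<in>space M. \<omega> \<in> E c} \<in> events" for c
      using subsetD[OF clock_events_sets E] by simp
    then show ?thesis unfolding eq by (intro sets.sets_Collect_finite_All) auto
  qed
  have "prob {\<omega>\<in>space M. counts (T \<omega>) y N t h n = K} = (\<Prod>c\<in>?C. prob (E c))"
    unfolding eq by (intro prob_clock_events E) simp
  also have "\<dots> = (\<Prod>c\<in>clocks_between (- N) N. prob (E (shift_clock y c)))"
    using inj_on_subset[OF inj_shift_clock] by (subst prod.reindex) auto
  also have "\<dots> = (\<Prod>c\<in>clocks_between (- N) N. \<Prod>i<n. poisson_weight (rate p c * h) (K i c))"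
    unfolding E_def using assms by (subst prob_window_counts) simp_all
  finally show "prob {\<omega>\<in>space M. counts (T \<omega>) y N t h n = K}
      = (\<Prod>c\<in>clocks_between (- N) N. \<Prod>i<n. poisson_weight (rate p c * h) (K i c))" .
qed

text \<open>The event that the height at \<open>x\<close> is frozen during \<open>{s..t}\<close>.\<close>

definition quiet :: "real \<Rightarrow> real \<Rightarrow> int \<Rightarrow> 'a set" where
  "quiet s t x = {\<omega>\<in>space M. rings (T \<omega> (Rightward x)) s t = 0 \<and> rings (T \<omega> (Leftward (x + 1))) s t = 0}"

lemma quiet_events: "0 \<le> s \<Longrightarrow> s \<le> t \<Longrightarrow> quiet s t x \<in> events"
  unfolding quiet_def by (intro sets.sets_Collect_conj measurable_sets_Collect[OF measurable_rings]) auto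

text \<open>The two clocks that move a given height have rates \<open>p\<close> and \<open>1 - p\<close>, which add up to \<open>1\<close>.\<close>

lemma prob_all_quiet:
  assumes "0 \<le> s" "s \<le> t" "finite J"
  shows "prob {\<omega>\<in>space M. \<forall>x\<in>J. \<omega> \<in> quiet s t x} = exp (- (t - s)) ^ card J"
proof -
  let ?E = "\<lambda>c. {\<omega>\<in>space M. rings (T \<omega> c) s t = 0}"
  let ?C = "Rightward ` J \<union> (\<lambda>x. Leftward (x + 1)) ` J"
  have "{\<omega>\<in>space M. \<forall>x\<in>J. \<omega> \<in> quiet s t x} = {\<omega>\<in>space M. \<forall>c\<in>?C. \<omega> \<in> ?E c}"
    by (auto simp: quiet_def)
  also have "prob \<dots> = (\<Prod>c\<in>?C. prob (?E c))"
    using assms by (intro prob_clock_events rings_clock_event) auto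
  also have "\<dots> = (\<Prod>c\<in>?C. exp (- (rate p c * (t - s))))"
    using prob_rings[OF assms(1,2)] by (simp add: poisson_weight_def)
  also have "\<dots> = (\<Prod>c\<in>Rightward ` J. exp (- (rate p c * (t - s))))
      * (\<Prod>c\<in>(\<lambda>x. Leftward (x + 1)) ` J. exp (- (rate p c * (t - s))))"
    using assms(3) by (intro prod.union_disjoint) auto
  also have "\<dots> = exp (- (p * (t - s))) ^ card J * exp (- ((1 - p) * (t - s))) ^ card J"
    by (simp add: prod.reindex inj_on_def)
  also have "\<dots> = exp (- (t - s)) ^ card J"
    unfolding power_mult_distrib[symmetric] exp_add[symmetric] by (simp add: algebra_simps)
  finally show ?thesis .
qed

text \<open>The product formula for the events themselves gives their independence, which passes to
complements through the generated sigma-algebras.\<close>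

lemma prob_none_quiet:
  assumes "0 \<le> s" "s \<le> t" "finite J"
  shows "prob {\<omega>\<in>space M. \<forall>x\<in>J. \<omega> \<notin> quiet s t x} = (1 - exp (- (t - s))) ^ card J"
proof (cases "J = {}")
  case True
  then show ?thesis by (simp add: prob_space)
next
  case False
  note q = quiet_events[OF assms(1,2)]
  have space: "quiet s t x \<subseteq> space M" for x by (auto simp: quiet_def)
  have single: "prob (quiet s t x) = exp (- (t - s))" for x
  proof -
    have "quiet s t x = {\<omega>\<in>space M. \<forall>x\<in>{x}. \<omega> \<in> quiet s t x}" using space by auto
    then show ?thesis using prob_all_quiet[OF assms(1,2), of "{x}"] by simp
  qed
  have "indep_sets (\<lambda>x. {quiet s t x}) UNIV"
  proof (rule indep_setsI)
    fix A J assume J: "(J :: int set) \<noteq> {}" "finite J" "\<forall>x\<in>J. A x \<in> {quiet s t x}"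
    then have "(\<Inter>x\<in>J. A x) = (\<Inter>x\<in>J. quiet s t x)" by simp
    also have "\<dots> = {\<omega>\<in>space M. \<forall>x\<in>J. \<omega> \<in> quiet s t x}"
      using J(1) by (auto simp: quiet_def)
    finally have "(\<Inter>x\<in>J. A x) = {\<omega>\<in>space M. \<forall>x\<in>J. \<omega> \<in> quiet s t x}" .
    moreover have "(\<Prod>x\<in>J. prob (A x)) = (\<Prod>x\<in>J. exp (- (t - s)))"
      using J single by (intro prod.cong) auto
    ultimately show "prob (\<Inter>x\<in>J. A x) = (\<Prod>x\<in>J. prob (A x))"
      using prob_all_quiet[OF assms(1,2) J(2)] by simp
  qed (use q in auto)
  then have ind: "indep_sets (\<lambda>x. sigma_sets (space M) {quiet s t x}) UNIV"
    by (rule indep_sets_sigma) (auto simp: Int_stable_def)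
  have "prob (\<Inter>x\<in>J. space M - quiet s t x) = (\<Prod>x\<in>J. prob (space M - quiet s t x))"
    using False assms(3) by (intro indep_setsD[OF ind]) (auto intro: sigma_sets.intros)
  also have "\<dots> = (1 - exp (- (t - s))) ^ card J" using q by (simp add: prob_compl single)
  also have "(\<Inter>x\<in>J. space M - quiet s t x) = {\<omega>\<in>space M. \<forall>x\<in>J. \<omega> \<notin> quiet s t x}"
    using False by auto
  finally show ?thesis .
qed

lemma quiet_imp_frozen:
  assumes "\<omega> \<in> quiet t (t + real n * h) (x + y)" "0 \<le> h"
  shows "frozen (counts (T \<omega>) y N t h n) n x"
proof -
  have "\<omega> \<in> space M" using assms by (simp add: quiet_def)
  then interpret driven_trajectory "T \<omega>" "\<eta> \<omega>" by (rule driven_trajectory)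
  have *: "rings (T \<omega> c) (t + real i * h) (t + real (Suc i) * h) = 0"
    if "rings (T \<omega> c) t (t + real n * h) = 0" "i < n" for c i
  proof -
    have "real (Suc i) * h \<le> real n * h" "0 \<le> real i * h"
      using that(2) assms(2) by (auto intro!: mult_right_mono simp del: of_nat_Suc)
    then have "{t + real i * h<..t + real (Suc i) * h} \<subseteq> {t<..t + real n * h}" by auto
    then show ?thesis using that(1) unfolding rings_eq_0 by blast
  qed
  show ?thesis using assms(1) by (auto simp: quiet_def frozen_def counts_def add.commute add.left_commute
      simp del: of_nat_Suc intro!: *)
qed

end

section \<open>Stochastic domination by the step initial condition\<close>

context pasep
begin

lemma prob_counts_in:
  assumes "0 \<le> t" "0 \<le> h" "0 < n" "finite S"
    and support: "\<forall>K\<in>S. \<forall>i c. \<not> (i < n \<and> c \<in> clocks_between (- N) N) \<longrightarrow> K i c = 0"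
  shows "{\<omega>\<in>space M. counts (T \<omega>) y N t h n \<in> S} \<in> events"
    and "prob {\<omega>\<in>space M. counts (T \<omega>) y N t h n \<in> S}
      = (\<Sum>K\<in>S. \<Prod>c\<in>clocks_between (- N) N. \<Prod>i<n. poisson_weight (rate p c * h) (K i c))"
proof -
  let ?E = "\<lambda>K. {\<omega>\<in>space M. counts (T \<omega>) y N t h n = K}"
  have eq: "{\<omega>\<in>space M. counts (T \<omega>) y N t h n \<in> S} = (\<Union>K\<in>S. ?E K)" by auto
  have law: "?E K \<in> events"
    "prob (?E K) = (\<Prod>c\<in>clocks_between (- N) N. \<Prod>i<n. poisson_weight (rate p c * h) (K i c))"
    if "K \<in> S" for K
    using that support by (intro counts_law assms(1-3); blast)+
  show "{\<omega>\<in>space M. counts (T \<omega>) y N t h n \<in> S} \<in> events"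
    unfolding eq using law(1) assms(4) by (intro sets.finite_UN) auto
  have "prob (\<Union>K\<in>S. ?E K) = (\<Sum>K\<in>S. prob (?E K))"
    using law(1) assms(4) by (intro finite_measure_finite_Union) (auto simp: disjoint_family_on_def)
  also have "\<dots> = (\<Sum>K\<in>S. \<Prod>c\<in>clocks_between (- N) N. \<Prod>i<n. poisson_weight (rate p c * h) (K i c))"
    using law(2) by (intro sum.cong) auto
  finally show "prob {\<omega>\<in>space M. counts (T \<omega>) y N t h n \<in> S}
      = (\<Sum>K\<in>S. \<Prod>c\<in>clocks_between (- N) N. \<Prod>i<n. poisson_weight (rate p c * h) (K i c))"
    unfolding eq .
qed

text \<open>The law of the initial configuration is given on the product space.  It is read off site by site,
and there are countably many sites.\<close>

lemma AE_initial:
  assumes "\<mu> = return config_space \<zeta>"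
  shows "AE \<omega> in M. \<eta> \<omega> 0 = \<zeta>"
proof -
  have "AE \<omega> in M. \<eta> \<omega> 0 x = \<zeta> x" for x
  proof -
    have [measurable]: "Measurable.pred config_space (\<lambda>\<xi>. \<xi> x = \<zeta> x)"
      using measurable_compose[OF measurable_component_singleton[of x UNIV "\<lambda>_. count_space UNIV"],
          of "\<lambda>b. b = \<zeta> x"] by simp
    have "AE \<xi> in distr M config_space (\<lambda>\<omega>. \<eta> \<omega> 0). \<xi> x = \<zeta> x"
      unfolding initial_law assms by (subst AE_return) (auto simp: space_PiM)
    then show ?thesis by (rule AE_distrD[OF measurable_config[OF order_refl]])
  qed
  then have "AE \<omega> in M. \<forall>x. \<eta> \<omega> 0 x = \<zeta> x" by (simp add: AE_all_countable)
  then show ?thesis by (simp add: fun_eq_iff)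
qed

lemma prob_crowded_window_tendsto_0:
  fixes y N :: int
  assumes "0 \<le> t" "0 \<le> s"
  defines "G \<equiv> \<lambda>n. {\<omega>\<in>space M. \<exists>i<n. 1 < (\<Sum>c\<in>clocks_between (- N) N. counts (T \<omega>) y N t (s / real n) n i c)}"
  shows "G n \<in> events" and "(\<lambda>n. prob (G n)) \<longlonglongrightarrow> 0"
proof -
  show events: "G n \<in> events" for n
  proof -
    have "(\<lambda>\<omega>. counts (T \<omega>) y N t (s / real n) n i c) \<in> measurable M (count_space UNIV)" for i c
    proof (cases "i < n \<and> c \<in> clocks_between (- N) N")
      case True
      have "0 \<le> s / real n" using assms(2) by simp
      then have "0 \<le> t + real i * (s / real n)"
        "t + real i * (s / real n) \<le> t + real (Suc i) * (s / real n)"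
        using assms(1) by (auto intro!: mult_right_mono add_nonneg_nonneg mult_nonneg_nonneg
            simp del: times_divide_eq_right)
      then show ?thesis unfolding counts_def using True by (simp only: if_True simp_thms) (rule measurable_rings)
    next
      case False
      then show ?thesis unfolding counts_def by (simp only: if_False) simp
    qed
    then have "(\<lambda>\<omega>. \<Sum>c\<in>clocks_between (- N) N. counts (T \<omega>) y N t (s / real n) n i c)
        \<in> measurable M (count_space UNIV)" for i
      by measurable
    then show ?thesis unfolding G_def by measurable
  qed
  show "(\<lambda>n. prob (G n)) \<longlonglongrightarrow> 0"
  proof (rule prob_tendsto_0_if_eventually_outside[OF events])
    fix \<omega> assume "\<omega> \<in> space M"
    then interpret driven_trajectory "T \<omega>" "\<eta> \<omega>" by (rule driven_trajectory)
    let ?C = "shift_clock y ` clocks_between (- N) N"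
    have "\<forall>\<^sub>F n in sequentially. \<forall>i<n.
        (\<Sum>c\<in>?C. rings (T \<omega> c) (t + real i * (s / n)) (t + real (Suc i) * (s / n))) \<le> 1"
      by (rule eventually_at_most_one_ring[OF _ assms(2)]) simp
    then show "\<forall>\<^sub>F n in sequentially. \<omega> \<notin> G n"
    proof eventually_elim
      case (elim n)
      have "(\<Sum>c\<in>clocks_between (- N) N. counts (T \<omega>) y N t (s / real n) n i c) \<le> 1" if "i < n" for i
      proof -
        have "(\<Sum>c\<in>clocks_between (- N) N. counts (T \<omega>) y N t (s / real n) n i c)
          = (\<Sum>c\<in>?C. rings (T \<omega> c) (t + real i * (s / n)) (t + real (Suc i) * (s / n)))"
          using inj_on_subset[OF inj_shift_clock] that
          by (subst sum.reindex) (auto simp: counts_def intro!: sum.cong)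
        then show ?thesis using elim that by simp
      qed
      then have "\<not> (\<exists>i<n. 1 < (\<Sum>c\<in>clocks_between (- N) N. counts (T \<omega>) y N t (s / real n) n i c))"
        by (meson not_le)
      then show ?case unfolding G_def by blast
    qed
  qed
qed

end

text \<open>Ring numbers for which the discrete evolution is faithful (at most one ring per window, frozen
sites at distance between \<open>k\<close> and \<open>N\<close> on both sides) and takes the wedge above \<open>\<alpha>\<close> at \<open>z\<close>.\<close>

definition admissible :: "int \<Rightarrow> int \<Rightarrow> nat \<Rightarrow> real \<Rightarrow> int \<Rightarrow> (nat \<Rightarrow> clock \<Rightarrow> nat) set" where
  "admissible N k n \<alpha> z = {K. (\<forall>i c. \<not> (i < n \<and> c \<in> clocks_between (- N) N) \<longrightarrow> K i c = 0)
     \<and> (\<forall>i<n. (\<Sum>c\<in>clocks_between (- N) N. K i c) \<le> 1)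
     \<and> (\<exists>a\<in>{- N..- k}. frozen K n a) \<and> (\<exists>b\<in>{k..N}. frozen K n b)
     \<and> \<alpha> < real_of_int (evolve K n abs z)}"

lemma finite_admissible: "finite (admissible N k n \<alpha> z)"
proof -
  let ?C = "clocks_between (- N) N"
  let ?B = "{g. \<forall>c. (c \<in> ?C \<longrightarrow> g c \<in> {0, 1}) \<and> (c \<notin> ?C \<longrightarrow> g c = (0::nat))}"
  have "finite {K. \<forall>i. (i \<in> {..<n} \<longrightarrow> K i \<in> ?B) \<and> (i \<notin> {..<n} \<longrightarrow> K i = (\<lambda>_. 0))}"
    by (intro finite_set_of_finite_funs) auto
  moreover have "K i c \<in> {0, 1}" if "K \<in> admissible N k n \<alpha> z" "i < n" "c \<in> ?C" for K i c
  proof -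
    have "K i c \<le> (\<Sum>c\<in>?C. K i c)" using that by (intro member_le_sum) auto
    also have "\<dots> \<le> 1" using that by (simp add: admissible_def)
    finally show ?thesis by auto
  qed
  then have "admissible N k n \<alpha> z
      \<subseteq> {K. \<forall>i. (i \<in> {..<n} \<longrightarrow> K i \<in> ?B) \<and> (i \<notin> {..<n} \<longrightarrow> K i = (\<lambda>_. 0))}"
    by (force simp: admissible_def fun_eq_iff)
  ultimately show ?thesis by (rule rev_finite_subset)
qed

context driven_trajectory
begin

text \<open>The wedge with tip \<open>(y, height_int \<xi> y t)\<close> bounds the profile at time \<open>t\<close> from above;
monotonicity of the evolution carries the bound to the end of the time span.\<close>

lemma height_increment_le_evolve:
  assumes "0 \<le> t" "0 \<le> h" "- N \<le> a" "a \<le> - k" "k \<le> b" "b \<le> N" "\<bar>y\<bar> < k" "\<bar>z\<bar> < k"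
    and sparse: "\<And>i. i < n \<Longrightarrow> (\<Sum>c\<in>clocks_between (- N) N. counts T y N t h n i c) \<le> 1"
    and frozen: "frozen (counts T y N t h n) n a" "frozen (counts T y N t h n) n b"
  shows "height_int \<xi> (z + y) (t + real n * h) - height_int \<xi> y t \<le> evolve (counts T y N t h n) n abs z"
proof -
  have "height_int \<xi> (z + y) (t + real n * h)
      = evolve (counts T y N t h n) n (\<lambda>x. height_int \<xi> (x + y) t) z"
    using assms by (intro heights_evolve[where a = a and b = b]) auto
  also have "\<dots> \<le> evolve (counts T y N t h n) n (\<lambda>x. \<bar>x\<bar> + height_int \<xi> y t) z"
  proof (rule evolve_mono[OF frozen order_refl])
    fix x show "height_int \<xi> (x + y) t \<le> \<bar>x\<bar> + height_int \<xi> y t"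
      using height_int_lipschitz[of \<xi> "x + y" t y] by auto
  qed (use assms in auto)
  finally show ?thesis by (simp add: evolve_add)
qed

lemma step_height_eq_evolve:
  assumes "\<xi> 0 = step_config" "0 \<le> h" "- N \<le> a" "a \<le> - k" "k \<le> b" "b \<le> N" "\<bar>z\<bar> < k"
    and sparse: "\<And>i. i < n \<Longrightarrow> (\<Sum>c\<in>clocks_between (- N) N. counts T 0 N 0 h n i c) \<le> 1"
    and frozen: "frozen (counts T 0 N 0 h n) n a" "frozen (counts T 0 N 0 h n) n b"
  shows "height_int \<xi> z (real n * h) = evolve (counts T 0 N 0 h n) n abs z"
proof -
  have "height_int \<xi> (z + 0) (0 + real n * h)
      = evolve (counts T 0 N 0 h n) n (\<lambda>x. height_int \<xi> (x + 0) 0) z"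
    using assms by (intro heights_evolve[where a = a and b = b]) auto
  then show ?thesis by (simp add: height_int_step[where \<xi> = \<xi>, OF assms(1)])
qed

end

text \<open>Up to three events of small probability, the event on the left forces the ring numbers into the
finite set of admissible ones.  The probability of this set is the same for both
processes, and for the step initial condition, whose profile is the wedge, it implies the event on
the right.  Choosing first the size of the box and then the number of windows makes the error
as small as desired.\<close>

lemma step_height_dominates:
  assumes M: "pasep M p \<mu> T \<eta>" and M': "pasep M' p (return config_space step_config) T' \<eta>'"
    and "0 \<le> t" "0 \<le> s"
  shows "measure M {\<omega>\<in>space M. \<alpha> < real_of_int (height_int (\<eta> \<omega>) x (t + s) - height_int (\<eta> \<omega>) y t)}
    \<le> measure M' {\<omega>\<in>space M'. \<alpha> < real_of_int (height_int (\<eta>' \<omega>) (x - y) s)}"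
proof (rule field_le_epsilon)
  fix e :: real assume "0 < e"
  interpret A: pasep M p \<mu> T \<eta> by (rule M)
  interpret B: pasep M' p "return config_space step_config" T' \<eta>' by (rule M')
  define z where "z = x - y"
  \<comment> \<open>Frozen sites at distance at least \<open>k\<close> from \<open>y\<close> enclose the origin, \<open>y\<close> and \<open>x\<close>.\<close>
  define k where "k = \<bar>y\<bar> + \<bar>z\<bar> + 1"
  have k: "\<bar>y\<bar> < k" "\<bar>z\<bar> < k" "0 < k" by (auto simp: k_def)
  \<comment> \<open>Each of the two flanks of the box has \<open>m\<close> candidates for a frozen site.\<close>
  obtain m where m: "(1 - exp (- s)) ^ m < e / 3"
    using real_arch_pow_inv[of "e / 3" "1 - exp (- s)"] \<open>0 < e\<close> by auto
  define N where "N = k + int m"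
  let ?J1 = "{y - N<..y - k}" and ?J2 = "{y + k..<y + N}"
  let ?q = "A.quiet t (t + s)"
  \<comment> \<open>The exceptional events: no frozen site on the left (\<open>L\<close>) or on the right (\<open>R\<close>), and a window
    with several rings (\<open>G n\<close>).\<close>
  define L where "L = {\<omega>\<in>space M. \<forall>a\<in>?J1. \<omega> \<notin> ?q a}"
  define R where "R = {\<omega>\<in>space M. \<forall>b\<in>?J2. \<omega> \<notin> ?q b}"
  have LR: "measure M L < e / 3" "measure M R < e / 3"
    using m \<open>0 \<le> t\<close> \<open>0 \<le> s\<close> by (simp_all add: L_def R_def A.prob_none_quiet N_def)
  have q: "?q a \<in> sets M" for a using \<open>0 \<le> t\<close> \<open>0 \<le> s\<close> by (intro A.quiet_events) auto
  have "L \<in> sets M" unfolding L_def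
    using q by (intro sets.sets_Collect_finite_All sets.sets_Collect_neg) (auto simp: A.quiet_def)
  have "R \<in> sets M" unfolding R_def
    using q by (intro sets.sets_Collect_finite_All sets.sets_Collect_neg) (auto simp: A.quiet_def)
  define G where "G n = {\<omega>\<in>space M. \<exists>i<n. 1 < (\<Sum>c\<in>clocks_between (- N) N.
    counts (T \<omega>) y N t (s / real n) n i c)}" for n
  note G = A.prob_crowded_window_tendsto_0[OF \<open>0 \<le> t\<close> \<open>0 \<le> s\<close>, where N = N and y = y, folded G_def]
  have "\<forall>\<^sub>F n in sequentially. measure M (G n) < e / 3 \<and> 0 < n"
    using order_tendstoD(2)[OF G(2), of "e / 3"] \<open>0 < e\<close> eventually_gt_at_top[of 0]
    by (auto intro: eventually_conj)
  then obtain n where n: "measure M (G n) < e / 3" "0 < n"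
    using eventually_happens trivial_limit_sequentially by blast
  define h where "h = s / real n"
  have h: "0 \<le> h" "real n * h = s" using n \<open>0 \<le> s\<close> by (simp_all add: h_def)
  define S where "S = admissible N k n \<alpha> z"
  have support: "\<forall>K\<in>S. \<forall>i c. \<not> (i < n \<and> c \<in> clocks_between (- N) N) \<longrightarrow> K i c = 0"
    by (simp add: S_def admissible_def)
  have finite: "finite S" unfolding S_def by (rule finite_admissible)
  note lawA = A.prob_counts_in[OF \<open>0 \<le> t\<close> h(1) n(2) finite support, where y = y]
  note lawB = B.prob_counts_in[OF order_refl h(1) n(2) finite support, where y = 0]
  let ?EA = "{\<omega>\<in>space M. counts (T \<omega>) y N t h n \<in> S}"
  let ?EB = "{\<omega>\<in>space M'. counts (T' \<omega>) 0 N 0 h n \<in> S}"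
  have "measure M {\<omega>\<in>space M. \<alpha> < real_of_int (height_int (\<eta> \<omega>) x (t + s) - height_int (\<eta> \<omega>) y t)}
      \<le> measure M (L \<union> R \<union> G n \<union> ?EA)"
  proof (rule A.finite_measure_mono)
    show "L \<union> R \<union> G n \<union> ?EA \<in> sets M"
      using \<open>L \<in> sets M\<close> \<open>R \<in> sets M\<close> G(1) lawA(1) by auto
    show "{\<omega>\<in>space M. \<alpha> < real_of_int (height_int (\<eta> \<omega>) x (t + s) - height_int (\<eta> \<omega>) y t)}
      \<subseteq> L \<union> R \<union> G n \<union> ?EA"
    proof
      fix \<omega>
      assume \<omega>: "\<omega> \<in> {\<omega>\<in>space M. \<alpha> < real_of_int (height_int (\<eta> \<omega>) x (t + s) - height_int (\<eta> \<omega>) y t)}"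
      then have "\<omega> \<in> space M" by simp
      then interpret driven_trajectory "T \<omega>" "\<eta> \<omega>" by (rule A.driven_trajectory)
      let ?K = "counts (T \<omega>) y N t h n"
      have "\<omega> \<in> ?EA" if "\<omega> \<notin> L" "\<omega> \<notin> R" "\<omega> \<notin> G n"
      proof -
        obtain a where a: "a \<in> ?J1" "\<omega> \<in> ?q a" using \<open>\<omega> \<notin> L\<close> \<open>\<omega> \<in> space M\<close> unfolding L_def by blast
        obtain b where b: "b \<in> ?J2" "\<omega> \<in> ?q b" using \<open>\<omega> \<notin> R\<close> \<open>\<omega> \<in> space M\<close> unfolding R_def by blast
        have frozen: "frozen ?K n (a - y)" "frozen ?K n (b - y)"
          using a(2) b(2) h by (auto intro!: A.quiet_imp_frozen)
        have sparse: "(\<Sum>c\<in>clocks_between (- N) N. ?K i c) \<le> 1" if "i < n" for i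
          using \<open>\<omega> \<notin> G n\<close> \<open>\<omega> \<in> space M\<close> that unfolding G_def h_def[symmetric] by force
        have "height_int (\<eta> \<omega>) (z + y) (t + real n * h) - height_int (\<eta> \<omega>) y t \<le> evolve ?K n abs z"
          using a(1) b(1) k sparse frozen \<open>0 \<le> t\<close> h(1)
          by (intro height_increment_le_evolve[where a = "a - y" and b = "b - y" and k = k]) auto
        then have "\<alpha> < real_of_int (evolve ?K n abs z)" using \<omega> h(2) by (simp add: z_def)
        moreover have "a - y \<in> {- N..- k}" "b - y \<in> {k..N}" using a(1) b(1) by auto
        ultimately have "?K \<in> S"
          unfolding S_def admissible_def using frozen sparse by (auto simp: counts_def)
        then show ?thesis using \<open>\<omega> \<in> space M\<close> by simp
      qed
      then show "\<omega> \<in> L \<union> R \<union> G n \<union> ?EA" by blast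
    qed
  qed
  also have "\<dots> \<le> measure M L + measure M R + measure M (G n) + measure M ?EA"
    using \<open>L \<in> sets M\<close> \<open>R \<in> sets M\<close> G(1) lawA(1)
    by (intro order_trans[OF measure_Un_le] add_right_mono) auto
  also have "\<dots> \<le> e + measure M ?EA" using LR n(1) by simp
  also have "measure M ?EA = measure M' ?EB" using lawA(2) lawB(2) by simp
  also have "\<dots> \<le> measure M' {\<omega>\<in>space M'. \<alpha> < real_of_int (height_int (\<eta>' \<omega>) (x - y) s)}"
  proof (rule B.finite_measure_mono_AE)
    show "{\<omega>\<in>space M'. \<alpha> < real_of_int (height_int (\<eta>' \<omega>) (x - y) s)} \<in> sets M'"
      using B.real_height_int_measurable[OF \<open>0 \<le> s\<close>] by measurable
    show "AE \<omega> in M'. \<omega> \<in> ?EB \<longrightarrow> \<omega> \<in> {\<omega>\<in>space M'. \<alpha> < real_of_int (height_int (\<eta>' \<omega>) (x - y) s)}"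
      using B.AE_initial[OF refl]
    proof (rule AE_mp, intro AE_I2 impI)
      fix \<omega> assume \<omega>: "\<omega> \<in> space M'" "\<eta>' \<omega> 0 = step_config" "\<omega> \<in> ?EB"
      interpret driven_trajectory "T' \<omega>" "\<eta>' \<omega>" using \<omega>(1) by (rule B.driven_trajectory)
      let ?K = "counts (T' \<omega>) 0 N 0 h n"
      have K: "?K \<in> S" using \<omega>(3) by simp
      then obtain a b where "a \<in> {- N..- k}" "frozen ?K n a" "b \<in> {k..N}" "frozen ?K n b"
        unfolding S_def admissible_def by blast
      moreover have "\<And>i. i < n \<Longrightarrow> (\<Sum>c\<in>clocks_between (- N) N. ?K i c) \<le> 1"
        using K by (simp add: S_def admissible_def)
      ultimately have "height_int (\<eta>' \<omega>) z (real n * h) = evolve ?K n abs z"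
        using \<omega>(2) h(1) k by (intro step_height_eq_evolve[where a = a and b = b and k = k]) auto
      then show "\<omega> \<in> {\<omega>\<in>space M'. \<alpha> < real_of_int (height_int (\<eta>' \<omega>) (x - y) s)}"
        using \<omega>(1) K h(2) by (simp add: S_def admissible_def z_def)
    qed
  qed
  finally show "measure M {\<omega>\<in>space M. \<alpha> < real_of_int (height_int (\<eta> \<omega>) x (t + s) - height_int (\<eta> \<omega>) y t)}
      \<le> measure M' {\<omega>\<in>space M'. \<alpha> < real_of_int (height_int (\<eta>' \<omega>) (x - y) s)} + e"
    by simp
qed

section \<open>Families with a common limit in distribution\<close>

lemma (in real_distribution) exists_continuity_point:
  assumes "a < b"
  obtains x where "a < x" "x < b" "isCont (cdf M) x"
proof -
  have "mono (cdf M)" by (simp add: mono_def cdf_nondecreasing)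
  then have "\<exists>x. x \<in> {a<..<b} - {x. \<not> isCont (cdf M) x}"
    using open_minus_countable[OF mono_ctble_discont, of "cdf M" "{a<..<b}"] assms by auto
  then show ?thesis using that by auto
qed

lemma (in real_distribution) exists_low_continuity_point:
  assumes "0 < e"
  obtains x where "cdf M x < e" "isCont (cdf M) x"
proof -
  have "\<forall>\<^sub>F x in at_bot. cdf M x < e"
    using order_tendstoD(2)[OF cdf_lim_at_bot] assms .
  then obtain b where b: "\<And>x. x \<le> b \<Longrightarrow> cdf M x < e" by (auto simp: eventually_at_bot_linorder)
  obtain x where "b - 1 < x" "x < b" "isCont (cdf M) x"
    using exists_continuity_point[of "b - 1" b] by auto
  then show ?thesis using that b[of x] by auto
qed

lemma (in real_distribution) exists_high_continuity_point:
  assumes "0 < e"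
  obtains x where "1 - e < cdf M x" "isCont (cdf M) x"
proof -
  have "\<forall>\<^sub>F x in at_top. 1 - e < cdf M x"
    using order_tendstoD(1)[OF cdf_lim_at_top_prob] assms by simp
  then obtain b where b: "\<And>x. b \<le> x \<Longrightarrow> 1 - e < cdf M x" by (auto simp: eventually_at_top_linorder)
  obtain x where "b < x" "x < b + 1" "isCont (cdf M) x"
    using exists_continuity_point[of b "b + 1"] by auto
  then show ?thesis using that b[of x] by auto
qed

context prob_space
begin

lemma prob_le_tendsto_cdf:
  assumes "converges_in_distr M X D" "isCont (cdf D) c"
    and "\<forall>\<^sub>F t in at_top. X t \<in> borel_measurable M"
  shows "((\<lambda>t. prob {\<omega>\<in>space M. X t \<omega> \<le> c}) \<longlongrightarrow> cdf D c) at_top"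
proof -
  have "((\<lambda>t. cdf (distr M borel (X t)) c) \<longlongrightarrow> cdf D c) at_top"
    using assms by (simp add: converges_in_distr_def)
  moreover have "\<forall>\<^sub>F t in at_top. cdf (distr M borel (X t)) c = prob {\<omega>\<in>space M. X t \<omega> \<le> c}"
    using assms(3)
  proof eventually_elim
    case (elim t)
    have "X t -` {..c} \<inter> space M = {\<omega>\<in>space M. X t \<omega> \<le> c}" by auto
    then show ?case using elim by (simp add: cdf_def measure_distr)
  qed
  ultimately show ?thesis by (rule Lim_transform_eventually)
qed

text \<open>A family that converges in distribution is tight.  The argument \<open>\<tau>\<close> allows a change of time.\<close>

lemma prob_exceeds_divergent_tendsto_0:
  assumes "real_distribution D" "converges_in_distr M Z D"
    and "\<forall>\<^sub>F t in at_top. Z t \<in> borel_measurable M"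
    and "filterlim \<tau> at_top F" "filterlim r at_top F"
  shows "((\<lambda>t. prob {\<omega>\<in>space M. r t < Z (\<tau> t) \<omega>}) \<longlongrightarrow> 0) F"
proof (rule order_tendstoI)
  fix e :: real assume "0 < e"
  interpret D: real_distribution D by fact
  obtain b where b: "1 - e < cdf D b" "isCont (cdf D) b"
    using D.exists_high_continuity_point[OF \<open>0 < e\<close>] .
  have "((\<lambda>t. prob {\<omega>\<in>space M. Z (\<tau> t) \<omega> \<le> b}) \<longlongrightarrow> cdf D b) F"
    using filterlim_compose[OF prob_le_tendsto_cdf[OF assms(2) b(2) assms(3)] assms(4)] .
  then have "\<forall>\<^sub>F t in F. 1 - e < prob {\<omega>\<in>space M. Z (\<tau> t) \<omega> \<le> b}"
    using b(1) by (rule order_tendstoD(1))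
  moreover have "\<forall>\<^sub>F t in F. Z (\<tau> t) \<in> borel_measurable M"
    using assms(3,4) by (rule eventually_compose_filterlim)
  moreover have "\<forall>\<^sub>F t in F. b \<le> r t"
    using assms(5) by (simp add: filterlim_at_top)
  ultimately show "\<forall>\<^sub>F t in F. prob {\<omega>\<in>space M. r t < Z (\<tau> t) \<omega>} < e"
  proof eventually_elim
    case (elim t)
    note [measurable] = elim(2)
    have "prob {\<omega>\<in>space M. r t < Z (\<tau> t) \<omega>} \<le> prob (space M - {\<omega>\<in>space M. Z (\<tau> t) \<omega> \<le> b})"
      using elim(3) by (intro finite_measure_mono) auto
    also have "\<dots> = 1 - prob {\<omega>\<in>space M. Z (\<tau> t) \<omega> \<le> b}" by (intro prob_compl) measurable
    finally show ?case using elim(1) by simp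
  qed
next
  fix e :: real assume "e < 0"
  then show "\<forall>\<^sub>F t in F. e < prob {\<omega>\<in>space M. r t < Z (\<tau> t) \<omega>}"
    by (intro always_eventually allI) (auto intro: less_le_trans)
qed

text \<open>For \<open>c' < c\<close>, up to the unlikely event \<open>c - c' < Y t - X t\<close>, the event \<open>X t \<le> c'\<close> is contained in
\<open>Y t \<le> c\<close> and it is disjoint from the crossing event.  So the crossing probability is
asymptotically at most \<open>cdf D c - cdf D c'\<close>, which is small for \<open>c'\<close> near the continuity point \<open>c\<close>.\<close>

lemma prob_crossing_tendsto_0:
  assumes D: "real_distribution D" and X: "converges_in_distr M X D" and Y: "converges_in_distr M Y D"
    and mX: "\<forall>\<^sub>F t in at_top. X t \<in> borel_measurable M"
    and mY: "\<forall>\<^sub>F t in at_top. Y t \<in> borel_measurable M"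
    and up: "\<And>e. 0 < e \<Longrightarrow> ((\<lambda>t. prob {\<omega>\<in>space M. e < Y t \<omega> - X t \<omega>}) \<longlongrightarrow> 0) at_top"
    and c: "isCont (cdf D) c"
  shows "((\<lambda>t. prob {\<omega>\<in>space M. Y t \<omega> \<le> c \<and> c < X t \<omega>}) \<longlongrightarrow> 0) at_top"
proof (rule order_tendstoI)
  fix e :: real assume "0 < e"
  interpret D: real_distribution D by fact
  obtain d where d: "0 < d" "\<And>x. \<bar>x - c\<bar> < d \<Longrightarrow> \<bar>cdf D x - cdf D c\<bar> < e / 4"
    using c \<open>0 < e\<close> unfolding continuous_at_eps_delta dist_real_def
    by (metis divide_pos_pos zero_less_numeral)
  obtain c' where c': "c - d < c'" "c' < c" "isCont (cdf D) c'"
    using D.exists_continuity_point[of "c - d" c] d(1) by auto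
  have close: "cdf D c - e / 4 < cdf D c'" proof -
    have "\<bar>c' - c\<bar> < d" using c' by simp
    from d(2)[OF this] show ?thesis by linarith
  qed
  have "\<forall>\<^sub>F t in at_top. prob {\<omega>\<in>space M. Y t \<omega> \<le> c} < cdf D c + e / 4"
    using prob_le_tendsto_cdf[OF Y c mY] by (rule order_tendstoD) (use \<open>0 < e\<close> in simp)
  moreover have "\<forall>\<^sub>F t in at_top. cdf D c' - e / 4 < prob {\<omega>\<in>space M. X t \<omega> \<le> c'}"
    using prob_le_tendsto_cdf[OF X c'(3) mX] by (rule order_tendstoD) (use \<open>0 < e\<close> in simp)
  moreover have "\<forall>\<^sub>F t in at_top. prob {\<omega>\<in>space M. c - c' < Y t \<omega> - X t \<omega>} < e / 4"
    using up[of "c - c'"] by (rule order_tendstoD) (use \<open>0 < e\<close> c' in simp_all)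
  ultimately show "\<forall>\<^sub>F t in at_top. prob {\<omega>\<in>space M. Y t \<omega> \<le> c \<and> c < X t \<omega>} < e"
    using mX mY
  proof eventually_elim
    case (elim t)
    note [measurable] = elim(4,5)
    let ?A = "{\<omega>\<in>space M. Y t \<omega> \<le> c \<and> c < X t \<omega>}"
    let ?B = "{\<omega>\<in>space M. X t \<omega> \<le> c' \<and> Y t \<omega> \<le> c}"
    let ?U = "{\<omega>\<in>space M. c - c' < Y t \<omega> - X t \<omega>}"
    have "prob {\<omega>\<in>space M. X t \<omega> \<le> c'} \<le> prob (?B \<union> ?U)"
      by (intro finite_measure_mono) auto
    also have "\<dots> \<le> prob ?B + prob ?U" by (intro measure_Un_le) measurable
    finally have 1: "prob {\<omega>\<in>space M. X t \<omega> \<le> c'} \<le> prob ?B + prob ?U" .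
    have "prob ?A + prob ?B = prob (?A \<union> ?B)"
      using c'(2) by (intro finite_measure_Union[symmetric]) (measurable, auto)
    also have "\<dots> \<le> prob {\<omega>\<in>space M. Y t \<omega> \<le> c}"
      by (intro finite_measure_mono) auto
    finally show ?case using 1 elim close by linarith
  qed
next
  fix e :: real assume "e < 0"
  then show "\<forall>\<^sub>F t in at_top. e < prob {\<omega>\<in>space M. Y t \<omega> \<le> c \<and> c < X t \<omega>}"
    by (intro always_eventually allI) (auto intro: less_le_trans)
qed

text \<open>If \<open>X t\<close> exceeds \<open>Y t\<close> by \<open>m\<close>, and both lie in a compact interval, then the gap between them contains
one of finitely many grid points, at which a crossing takes place.  Tightness takes care of
the complement of the interval.\<close>

lemma prob_gap_tendsto_0:
  assumes D: "real_distribution D" and X: "converges_in_distr M X D" and Y: "converges_in_distr M Y D"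
    and mX: "\<forall>\<^sub>F t in at_top. X t \<in> borel_measurable M"
    and mY: "\<forall>\<^sub>F t in at_top. Y t \<in> borel_measurable M"
    and up: "\<And>e. 0 < e \<Longrightarrow> ((\<lambda>t. prob {\<omega>\<in>space M. e < Y t \<omega> - X t \<omega>}) \<longlongrightarrow> 0) at_top"
    and "0 < m"
  shows "((\<lambda>t. prob {\<omega>\<in>space M. m \<le> \<bar>Y t \<omega> - X t \<omega>\<bar>}) \<longlongrightarrow> 0) at_top"
proof (rule order_tendstoI)
  fix e :: real assume "0 < e"
  interpret D: real_distribution D by fact
  obtain a where a: "cdf D a < e / 4" "isCont (cdf D) a"
    using D.exists_low_continuity_point[of "e / 4"] \<open>0 < e\<close> by auto
  obtain b where b: "1 - e / 4 < cdf D b" "isCont (cdf D) b"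
    using D.exists_high_continuity_point[of "e / 4"] \<open>0 < e\<close> by auto
  \<comment> \<open>One continuity point in each cell of width \<open>m / 2\<close>, so that a gap of width \<open>m\<close> that starts above
    \<open>a\<close> contains one of them.\<close>
  have "\<exists>x. a + real i * (m / 2) < x \<and> x < a + real (Suc i) * (m / 2) \<and> isCont (cdf D) x" for i
  proof -
    have "a + real i * (m / 2) < a + real (Suc i) * (m / 2)" using \<open>0 < m\<close> by (simp add: field_simps)
    then show ?thesis by (rule D.exists_continuity_point) blast
  qed
  then obtain f where f: "\<And>i. a + real i * (m / 2) < f i" "\<And>i. f i < a + real (Suc i) * (m / 2)"
    "\<And>i. isCont (cdf D) (f i)" by metis
  obtain k :: nat where k: "2 * (b - a) / m \<le> real k" using real_arch_simple by blast
  let ?U = "\<lambda>t. {\<omega>\<in>space M. m / 2 < Y t \<omega> - X t \<omega>}"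
  let ?A = "\<lambda>t. {\<omega>\<in>space M. Y t \<omega> \<le> a}"
  let ?B = "\<lambda>t. {\<omega>\<in>space M. X t \<omega> \<le> b}"
  let ?C = "\<lambda>i t. {\<omega>\<in>space M. Y t \<omega> \<le> f i \<and> f i < X t \<omega>}"
  have "((\<lambda>t. \<Sum>i\<le>Suc k. prob (?C i t)) \<longlongrightarrow> (\<Sum>i\<le>Suc k. 0)) at_top"
    using f(3) by (intro tendsto_sum prob_crossing_tendsto_0[OF D X Y mX mY up])
  then have "\<forall>\<^sub>F t in at_top. (\<Sum>i\<le>Suc k. prob (?C i t)) < e / 4"
    by (rule order_tendstoD) (use \<open>0 < e\<close> in simp)
  moreover have "\<forall>\<^sub>F t in at_top. prob (?U t) < e / 4"
    using up[of "m / 2"] by (rule order_tendstoD) (use \<open>0 < e\<close> \<open>0 < m\<close> in simp_all)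
  moreover have "\<forall>\<^sub>F t in at_top. prob (?A t) < e / 4"
    using prob_le_tendsto_cdf[OF Y a(2) mY] a(1) by (rule order_tendstoD)
  moreover have "\<forall>\<^sub>F t in at_top. 1 - e / 4 < prob (?B t)"
    using prob_le_tendsto_cdf[OF X b(2) mX] b(1) by (rule order_tendstoD)
  ultimately show "\<forall>\<^sub>F t in at_top. prob {\<omega>\<in>space M. m \<le> \<bar>Y t \<omega> - X t \<omega>\<bar>} < e"
    using mX mY
  proof eventually_elim
    case (elim t)
    note [measurable] = elim(5,6)
    have "{\<omega>\<in>space M. m \<le> \<bar>Y t \<omega> - X t \<omega>\<bar>} \<subseteq> ?U t \<union> ?A t \<union> (space M - ?B t) \<union> (\<Union>i\<le>Suc k. ?C i t)"
    proof
      fix \<omega> assume \<omega>: "\<omega> \<in> {\<omega>\<in>space M. m \<le> \<bar>Y t \<omega> - X t \<omega>\<bar>}"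
      show "\<omega> \<in> ?U t \<union> ?A t \<union> (space M - ?B t) \<union> (\<Union>i\<le>Suc k. ?C i t)"
      proof (rule ccontr)
        assume not: "\<not> ?thesis"
        then have *: "Y t \<omega> - X t \<omega> \<le> m / 2" "a < Y t \<omega>" "X t \<omega> \<le> b" using \<omega> by auto
        then have gap: "Y t \<omega> + m \<le> X t \<omega>" using \<omega> \<open>0 < m\<close> by (auto simp: abs_if split: if_splits)
        define i where "i = nat \<lceil>2 * (Y t \<omega> - a) / m\<rceil>"
        have i: "2 * (Y t \<omega> - a) / m \<le> real i" "real i < 2 * (Y t \<omega> - a) / m + 1"
          using *(2) \<open>0 < m\<close> by (simp_all add: i_def) linarith+
        have "2 * (Y t \<omega> - a) / m \<le> 2 * (b - a) / m"
          using gap *(3) \<open>0 < m\<close> by (intro divide_right_mono) auto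
        then have "i \<le> Suc k" using i(2) k by linarith
        moreover have "Y t \<omega> - a \<le> real i * (m / 2)" "real i * (m / 2) < Y t \<omega> - a + m / 2"
          using i \<open>0 < m\<close> by (simp_all add: field_simps)
        then have "Y t \<omega> \<le> f i" "f i < X t \<omega>"
          using f(1,2)[of i] gap by (simp_all add: algebra_simps add_divide_distrib)
        ultimately show False using not \<omega> by auto
      qed
    qed
    then have "prob {\<omega>\<in>space M. m \<le> \<bar>Y t \<omega> - X t \<omega>\<bar>}
        \<le> prob (?U t \<union> ?A t \<union> (space M - ?B t) \<union> (\<Union>i\<le>Suc k. ?C i t))"
      by (intro finite_measure_mono) measurable
    also have "\<dots> \<le> prob (?U t) + prob (?A t) + prob (space M - ?B t) + prob (\<Union>i\<le>Suc k. ?C i t)"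
      by (intro order_trans[OF measure_Un_le] add_right_mono order_refl) measurable
    also have "prob (\<Union>i\<le>Suc k. ?C i t) \<le> (\<Sum>i\<le>Suc k. prob (?C i t))"
      by (intro finite_measure_subadditive_finite) auto
    also have "prob (space M - ?B t) = 1 - prob (?B t)" by (intro prob_compl) measurable
    finally show ?case using elim by simp
  qed
next
  fix e :: real assume "e < 0"
  then show "\<forall>\<^sub>F t in at_top. e < prob {\<omega>\<in>space M. m \<le> \<bar>Y t \<omega> - X t \<omega>\<bar>}"
    by (intro always_eventually allI) (auto intro: less_le_trans)
qed

end

section \<open>Slow decorrelation\<close>

lemma height_near_floor: "\<bar>height \<xi> x t - real_of_int (height_int \<xi> \<lfloor>x\<rfloor> t)\<bar> \<le> 1"
proof -
  let ?d = "real_of_int (height_int \<xi> (\<lfloor>x\<rfloor> + 1) t - height_int \<xi> \<lfloor>x\<rfloor> t)"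
  have "\<bar>height_int \<xi> (\<lfloor>x\<rfloor> + 1) t - height_int \<xi> \<lfloor>x\<rfloor> t\<bar> \<le> 1"
    using height_int_lipschitz[of \<xi> "\<lfloor>x\<rfloor> + 1" t "\<lfloor>x\<rfloor>"] by simp
  then have "\<bar>?d\<bar> \<le> 1" by linarith
  moreover have "height \<xi> x t - real_of_int (height_int \<xi> \<lfloor>x\<rfloor> t) = frac x * ?d"
    by (simp add: height_def algebra_simps)
  ultimately show ?thesis
    using frac_ge_0[of x] frac_lt_1[of x] by (simp add: abs_mult mult_le_one)
qed

text \<open>The loss of \<open>4\<close> comes from rounding: \<open>1\<close> for each of the three interpolated heights, and \<open>1\<close>
because the rounded points differ by \<open>w\<close> rounded down or up.\<close>

lemma step_height_dominates_real:
  assumes M: "pasep M p \<mu> T \<eta>" and M': "pasep M' p (return config_space step_config) T' \<eta>'"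
    and "0 \<le> t" "0 \<le> s"
  shows "measure M {\<omega>\<in>space M. \<beta> < height (\<eta> \<omega>) (x + w) (t + s) - height (\<eta> \<omega>) x t}
    \<le> measure M' {\<omega>\<in>space M'. \<beta> - 4 < height (\<eta>' \<omega>) w s}"
proof -
  interpret A: pasep M p \<mu> T \<eta> by (rule M)
  interpret B: pasep M' p "return config_space step_config" T' \<eta>' by (rule M')
  let ?x = "\<lfloor>x + w\<rfloor>" and ?y = "\<lfloor>x\<rfloor>"
  have "0 \<le> t + s" using assms(3,4) by simp
  note [measurable] = A.real_height_int_measurable[OF \<open>0 \<le> t\<close>]
    A.real_height_int_measurable[OF \<open>0 \<le> t + s\<close>] B.height_measurable[OF \<open>0 \<le> s\<close>]
  have "measure M {\<omega>\<in>space M. \<beta> < height (\<eta> \<omega>) (x + w) (t + s) - height (\<eta> \<omega>) x t}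
    \<le> measure M {\<omega>\<in>space M. \<beta> - 2 < real_of_int (height_int (\<eta> \<omega>) ?x (t + s) - height_int (\<eta> \<omega>) ?y t)}"
  proof (rule A.finite_measure_mono)
    show "{\<omega>\<in>space M. \<beta> < height (\<eta> \<omega>) (x + w) (t + s) - height (\<eta> \<omega>) x t}
      \<subseteq> {\<omega>\<in>space M. \<beta> - 2 < real_of_int (height_int (\<eta> \<omega>) ?x (t + s) - height_int (\<eta> \<omega>) ?y t)}"
    proof (intro Collect_mono impI conjI; elim conjE)
      fix \<omega> assume "\<beta> < height (\<eta> \<omega>) (x + w) (t + s) - height (\<eta> \<omega>) x t"
      then show "\<beta> - 2 < real_of_int (height_int (\<eta> \<omega>) ?x (t + s) - height_int (\<eta> \<omega>) ?y t)"
        using height_near_floor[of "\<eta> \<omega>" "x + w" "t + s"] height_near_floor[of "\<eta> \<omega>" x t]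
        by (simp add: abs_le_iff)
    qed
    show "{\<omega>\<in>space M. \<beta> - 2 < real_of_int (height_int (\<eta> \<omega>) ?x (t + s) - height_int (\<eta> \<omega>) ?y t)}
      \<in> sets M"
      unfolding of_int_diff by measurable
  qed
  also have "\<dots> \<le> measure M' {\<omega>\<in>space M'. \<beta> - 2 < real_of_int (height_int (\<eta>' \<omega>) (?x - ?y) s)}"
    by (rule step_height_dominates[OF M M' \<open>0 \<le> t\<close> \<open>0 \<le> s\<close>])
  also have "\<dots> \<le> measure M' {\<omega>\<in>space M'. \<beta> - 4 < height (\<eta>' \<omega>) w s}"
  proof (rule B.finite_measure_mono)
    have floors: "\<bar>?x - ?y - \<lfloor>w\<rfloor>\<bar> \<le> 1" by linarith
    show "{\<omega>\<in>space M'. \<beta> - 2 < real_of_int (height_int (\<eta>' \<omega>) (?x - ?y) s)}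
      \<subseteq> {\<omega>\<in>space M'. \<beta> - 4 < height (\<eta>' \<omega>) w s}"
    proof (intro Collect_mono impI conjI; elim conjE)
      fix \<omega> assume "\<beta> - 2 < real_of_int (height_int (\<eta>' \<omega>) (?x - ?y) s)"
      moreover have "height_int (\<eta>' \<omega>) (?x - ?y) s \<le> height_int (\<eta>' \<omega>) \<lfloor>w\<rfloor> s + 1"
        using height_int_lipschitz[of "\<eta>' \<omega>" "?x - ?y" s "\<lfloor>w\<rfloor>"] floors by linarith
      then have "real_of_int (height_int (\<eta>' \<omega>) (?x - ?y) s) \<le> real_of_int (height_int (\<eta>' \<omega>) \<lfloor>w\<rfloor> s) + 1"
        by linarith
      ultimately show "\<beta> - 4 < height (\<eta>' \<omega>) w s"
        using height_near_floor[of "\<eta>' \<omega>" w s] by linarith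
    qed
  qed measurable
  finally show ?thesis .
qed

theorem theorem3p2:
  fixes p v u l l' \<gamma> \<gamma>' \<nu> :: real
    and M :: "'a measure" and \<mu> :: "config measure"
    and T :: "'a \<Rightarrow> clock \<Rightarrow> real set" and \<eta> :: "'a \<Rightarrow> real \<Rightarrow> config"
    and M' :: "'b measure"
    and T' :: "'b \<Rightarrow> clock \<Rightarrow> real set" and \<eta>' :: "'b \<Rightarrow> real \<Rightarrow> config"
    and D D' :: "real measure"
  assumes "1 / 2 < p" "p \<le> 1"
    and "pasep M p \<mu> T \<eta>"
    and "pasep M' p (return config_space step_config) T' \<eta>'"
    and "0 \<le> l" "0 \<le> l'"
    and "0 < \<gamma>" "\<gamma> < 1" "0 < \<gamma>'" "\<gamma>' < 1"
    and "0 < \<nu>" "\<nu> < \<gamma> / \<gamma>'"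
    and "real_distribution D" "real_distribution D'"
    and "converges_in_distr M
           (\<lambda>t \<omega>. (height (\<eta> \<omega>) (v * t) t - t * l) / t powr \<gamma>) D"
    and "converges_in_distr M
           (\<lambda>t \<omega>. (height (\<eta> \<omega>) (v * t + u * t powr \<nu>) (t + t powr \<nu>) - t * l - t powr \<nu> * l')
                   / t powr \<gamma>) D"
    and "converges_in_distr M'
           (\<lambda>t \<omega>. (height (\<eta>' \<omega>) (u * t) t - t * l') / t powr \<gamma>') D'"
  shows "\<forall>m>0. ((\<lambda>t. measure M {\<omega> \<in> space M.
            \<bar>height (\<eta> \<omega>) (v * t + u * t powr \<nu>) (t + t powr \<nu>) - height (\<eta> \<omega>) (v * t) t
              - t powr \<nu> * l'\<bar> \<ge> m * t powr \<gamma>}) \<longlongrightarrow> 0) at_top"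
proof (intro allI impI)
  fix m :: real assume "0 < m"
  interpret A: pasep M p \<mu> T \<eta> by fact
  interpret B: pasep M' p "return config_space step_config" T' \<eta>' by fact
  define X where "X = (\<lambda>t \<omega>. (height (\<eta> \<omega>) (v * t) t - t * l) / t powr \<gamma>)"
  define Y where "Y = (\<lambda>t \<omega>. (height (\<eta> \<omega>) (v * t + u * t powr \<nu>) (t + t powr \<nu>) - t * l - t powr \<nu> * l')
    / t powr \<gamma>)"
  define Z where "Z = (\<lambda>t \<omega>. (height (\<eta>' \<omega>) (u * t) t - t * l') / t powr \<gamma>')"
  have mX: "\<forall>\<^sub>F t in at_top. X t \<in> borel_measurable M"
    using eventually_ge_at_top[of 0]
    by eventually_elim (use A.height_measurable in \<open>simp add: X_def\<close>)
  have mY: "\<forall>\<^sub>F t in at_top. Y t \<in> borel_measurable M"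
    using eventually_ge_at_top[of 0]
    by eventually_elim (use A.height_measurable in \<open>simp add: Y_def\<close>)
  have mZ: "\<forall>\<^sub>F t in at_top. Z t \<in> borel_measurable M'"
    using eventually_ge_at_top[of 0]
    by eventually_elim (use B.height_measurable in \<open>simp add: Z_def\<close>)
  have diff: "(Y t \<omega> - X t \<omega>) * t powr \<gamma> = height (\<eta> \<omega>) (v * t + u * t powr \<nu>) (t + t powr \<nu>)
      - height (\<eta> \<omega>) (v * t) t - t powr \<nu> * l'" if "0 < t" for t \<omega>
    using that by (simp add: X_def Y_def diff_divide_distrib[symmetric])
  have up: "((\<lambda>t. measure M {\<omega>\<in>space M. e < Y t \<omega> - X t \<omega>}) \<longlongrightarrow> 0) at_top" if "0 < e" for e
  proof (rule tendsto_sandwich[OF _ _ tendsto_const])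
    \<comment> \<open>An excess of \<open>e\<close> on the scale of \<open>Y - X\<close>, minus the rounding loss, on the scale of \<open>Z\<close>
      at time \<open>t powr \<nu>\<close>.\<close>
    define r where "r t = (e * t powr \<gamma> - 4) / t powr (\<nu> * \<gamma>')" for t
    have "\<nu> * \<gamma>' < \<gamma>" using assms(9,12) by (simp add: field_simps)
    then have "filterlim r at_top at_top"
      unfolding r_def using \<open>0 < e\<close> assms(7,9,11) mult_pos_pos[OF assms(11,9)] by real_asymp
    moreover have "filterlim (\<lambda>t. t powr \<nu>) at_top at_top"
      using assms(11) by real_asymp
    ultimately show "((\<lambda>t. measure M' {\<omega>\<in>space M'. r t < Z (t powr \<nu>) \<omega>}) \<longlongrightarrow> 0) at_top"
      using assms(14,17) mZ unfolding Z_def[symmetric]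
      by (intro B.prob_exceeds_divergent_tendsto_0[of D' Z]) auto
    show "\<forall>\<^sub>F t in at_top. measure M {\<omega>\<in>space M. e < Y t \<omega> - X t \<omega>}
        \<le> measure M' {\<omega>\<in>space M'. r t < Z (t powr \<nu>) \<omega>}"
      using eventually_gt_at_top[of 0]
    proof eventually_elim
      case (elim t)
      let ?s = "t powr \<nu>"
      have source: "{\<omega>\<in>space M. e < Y t \<omega> - X t \<omega>} = {\<omega>\<in>space M. e * t powr \<gamma> + ?s * l' <
          height (\<eta> \<omega>) (v * t + u * ?s) (t + ?s) - height (\<eta> \<omega>) (v * t) t}"
      proof (rule Collect_cong)
        fix \<omega>
        have "e < Y t \<omega> - X t \<omega> \<longleftrightarrow> e * t powr \<gamma> < (Y t \<omega> - X t \<omega>) * t powr \<gamma>"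
          using elim by simp
        then show "(\<omega> \<in> space M \<and> e < Y t \<omega> - X t \<omega>) = (\<omega> \<in> space M \<and> e * t powr \<gamma> + ?s * l' <
          height (\<eta> \<omega>) (v * t + u * ?s) (t + ?s) - height (\<eta> \<omega>) (v * t) t)"
          unfolding diff[OF elim] by auto
      qed
      have target: "{\<omega>\<in>space M'. e * t powr \<gamma> + ?s * l' - 4 < height (\<eta>' \<omega>) (u * ?s) ?s}
          = {\<omega>\<in>space M'. r t < Z ?s \<omega>}"
      proof (rule Collect_cong)
        fix \<omega>
        have "r t < Z ?s \<omega> \<longleftrightarrow> e * t powr \<gamma> - 4 < height (\<eta>' \<omega>) (u * ?s) ?s - ?s * l'"
          using elim by (simp add: r_def Z_def powr_powr divide_less_cancel)
        then show "(\<omega> \<in> space M' \<and> e * t powr \<gamma> + ?s * l' - 4 < height (\<eta>' \<omega>) (u * ?s) ?s)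
          = (\<omega> \<in> space M' \<and> r t < Z ?s \<omega>)" by argo
      qed
      show ?case unfolding source target[symmetric]
        by (rule step_height_dominates_real[OF assms(3,4)]) (use elim in simp_all)
    qed
  qed (intro always_eventually allI, simp)
  have "((\<lambda>t. measure M {\<omega>\<in>space M. m \<le> \<bar>Y t \<omega> - X t \<omega>\<bar>}) \<longlongrightarrow> 0) at_top"
    using assms(15,16) unfolding X_def[symmetric] Y_def[symmetric]
    by (intro A.prob_gap_tendsto_0[OF assms(13) _ _ mX mY up \<open>0 < m\<close>])
  moreover have "\<forall>\<^sub>F t in at_top. measure M {\<omega>\<in>space M. m \<le> \<bar>Y t \<omega> - X t \<omega>\<bar>} = measure M {\<omega> \<in> space M.
      \<bar>height (\<eta> \<omega>) (v * t + u * t powr \<nu>) (t + t powr \<nu>) - height (\<eta> \<omega>) (v * t) t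
        - t powr \<nu> * l'\<bar> \<ge> m * t powr \<gamma>}"
    using eventually_gt_at_top[of 0]
  proof eventually_elim
    case (elim t)
    have "m \<le> \<bar>Y t \<omega> - X t \<omega>\<bar> \<longleftrightarrow> m * t powr \<gamma> \<le> \<bar>(Y t \<omega> - X t \<omega>) * t powr \<gamma>\<bar>" for \<omega>
      using elim by (simp add: abs_mult)
    then show ?case unfolding diff[OF elim] by simp
  qed
  ultimately show "((\<lambda>t. measure M {\<omega> \<in> space M.
      \<bar>height (\<eta> \<omega>) (v * t + u * t powr \<nu>) (t + t powr \<nu>) - height (\<eta> \<omega>) (v * t) t
        - t powr \<nu> * l'\<bar> \<ge> m * t powr \<gamma>}) \<longlongrightarrow> 0) at_top"
    by (rule Lim_transform_eventually)
qed

end
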